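(* Let $p,q\in\mathbb{R}[x]$. If $\mathscr{W}(p)$ and $\mathscr{W}(q)$ have nonnegative symmetric decompositions, then so does $\mathscr{W}(pq)$. Furthermore, if the symmetric decompositions of $\mathscr{W}(p)$ and $\mathscr{W}(q)$ are $\gamma$-positive, then so is the symmetric decomposition of $\mathscr{W}(pq)$.
   Context: For a polynomial $p\in\mathbb{R}[x]$ of degree $d$, $\mathscr{W}(p)$ denotes the polynomial of degree at most $d$ defined by $\sum_{j\ge0}p(j)x^j=\mathscr{W}(p)(x)/(1-x)^{d+1}$. For a polynomial $a$ of degree at most $s$ let $\mathcal{I}_s(a)(x)=x^sa(1/x)$. Every polynomial $h$ of degree at most $d$ can be written uniquely as $h(x)=a(x)+x\,b(x)$ with $\mathcal{I}_d(a)=a$ and $\mathcal{I}_{d-1}(b)=b$; the pair $(a,b)$ is the symmetric decomposition of $h$ (with respect to $d$). The symmetric decomposition of $\mathscr{W}(p)$ is taken with respect to $d=\deg p$. It is nonnegative if $a$ and $b$ have only nonnegative coefficients, and $\gamma$-positive if $a=\sum_i\gamma_ix^i(1+x)^{d-2i}$ and $b=\sum_k\delta_kx^k(1+x)^{d-1-2k}$ with all $\gamma_i,\delta_k\ge0$. *)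

theory Defs
  imports "HOL-Computational_Algebra.Computational_Algebra"
begin

definition W_poly :: "real poly \<Rightarrow> real poly" where
  "W_poly p = (THE w. degree w \<le> degree p \<and>
     Abs_fps (\<lambda>j. poly p (of_nat j)) = fps_of_poly w / (1 - fps_X) ^ (degree p + 1))"

text \<open>For \<open>degree a \<le> s\<close> this is the polynomial \<open>x^s a(1/x)\<close>, since
  \<open>reflect_poly a\<close> is \<open>x^(degree a) a(1/x)\<close>.\<close>

definition I_poly :: "nat \<Rightarrow> real poly \<Rightarrow> real poly" where
  "I_poly s a = monom 1 (s - degree a) * reflect_poly a"

lemma poly_I_poly:
  assumes "degree a \<le> s" "x \<noteq> 0"
  shows "poly (I_poly s a) x = x ^ s * poly a (1 / x)"
proof -
  have "x ^ (s - degree a) * x ^ degree a = x ^ s"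
    using assms by (simp flip: power_add)
  then show ?thesis
    using assms by (simp add: I_poly_def poly_monom poly_reflect_poly_nz inverse_eq_divide flip: mult.assoc)
qed

text \<open>For \<open>d = 0\<close> the second component has degree at most \<open>-1\<close>, so it is \<open>0\<close>; this case is
  separated because \<open>d - 1\<close> truncates on the natural numbers.\<close>

definition is_symm_decomp :: "nat \<Rightarrow> real poly \<Rightarrow> real poly \<times> real poly \<Rightarrow> bool" where
  "is_symm_decomp d h = (\<lambda>(a, b).
     h = a + [:0, 1:] * b \<and>
     degree a \<le> d \<and> I_poly d a = a \<and>
     (if d = 0 then b = 0 else degree b \<le> d - 1 \<and> I_poly (d - 1) b = b))"

definition symm_decomp :: "nat \<Rightarrow> real poly \<Rightarrow> real poly \<times> real poly" where
  "symm_decomp d h = (THE ab. is_symm_decomp d h ab)"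

definition nonneg_symm_decomp :: "nat \<Rightarrow> real poly \<Rightarrow> bool" where
  "nonneg_symm_decomp d h \<longleftrightarrow> (case symm_decomp d h of (a, b) \<Rightarrow>
     (\<forall>i. coeff a i \<ge> 0) \<and> (\<forall>i. coeff b i \<ge> 0))"

definition gamma_positive_symm_decomp :: "nat \<Rightarrow> real poly \<Rightarrow> bool" where
  "gamma_positive_symm_decomp d h \<longleftrightarrow> (case symm_decomp d h of (a, b) \<Rightarrow>
     \<exists>\<gamma> \<delta> :: nat \<Rightarrow> real. (\<forall>i. \<gamma> i \<ge> 0) \<and> (\<forall>k. \<delta> k \<ge> 0) \<and>
       a = (\<Sum>i | 2 * i \<le> d. smult (\<gamma> i) (monom 1 i * [:1, 1:] ^ (d - 2 * i))) \<and>
       b = (\<Sum>k | 2 * k + 1 \<le> d. smult (\<delta> k) (monom 1 k * [:1, 1:] ^ (d - 1 - 2 * k))))"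

lemma degree_shift_diff:
  fixes p :: "real poly"
  assumes "degree p \<le> Suc n"
  shows "degree (pcompose p [:1, 1:] - p) \<le> n"
proof (cases "degree p = 0")
  case True
  then obtain c where "p = [:c:]" by (auto elim: degree_eq_zeroE)
  then show ?thesis by simp
next
  case False
  let ?q = "pcompose p [:1, 1:] - p"
  have deg: "degree (pcompose p [:1, 1:]) = degree p" by (simp add: degree_pcompose)
  have "coeff (pcompose p [:1, 1:]) (degree p) = coeff p (degree p)"
    using lead_coeff_comp[of "[:1, 1:]" p] deg by simp
  then have "coeff ?q i = 0" if "i > n" for i
    using that assms deg coeff_eq_0[of p i] coeff_eq_0[of "pcompose p [:1, 1:]" i]
    by (cases "i = degree p") auto
  then show ?thesis by (simp add: degree_le)
qed

lemma W_poly_exists_aux: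
  fixes p :: "real poly"
  assumes "degree p \<le> n"
  shows "\<exists>w. degree w \<le> n \<and>
    Abs_fps (\<lambda>j. poly p (of_nat j)) * (1 - fps_X) ^ Suc n = fps_of_poly w"
  using assms
proof (induction n arbitrary: p)
  case 0
  then obtain c where c: "p = [:c:]" by (auto elim: degree_eq_zeroE)
  have "Abs_fps (\<lambda>j. poly p (of_nat j)) * (1 - fps_X) = fps_of_poly [:c:]"
    by (rule fps_ext) (simp add: c right_diff_distrib coeff_pCons split: nat.splits)
  then show ?case by (intro exI[of _ "[:c:]"]) simp
next
  case (Suc n)
  let ?q = "pcompose p [:1, 1:] - p"
  let ?A = "\<lambda>p :: real poly. Abs_fps (\<lambda>j. poly p (of_nat j))"
  obtain w where w: "degree w \<le> n" "?A ?q * (1 - fps_X) ^ Suc n = fps_of_poly w"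
    using Suc.IH[OF degree_shift_diff[OF Suc.prems]] by blast
  have step: "?A p * (1 - fps_X) = fps_const (poly p 0) + fps_X * ?A ?q"
  proof (rule fps_ext)
    fix j
    show "fps_nth (?A p * (1 - fps_X)) j = fps_nth (fps_const (poly p 0) + fps_X * ?A ?q) j"
      by (cases j) (simp_all add: right_diff_distrib poly_pcompose add.commute)
  qed
  let ?w = "smult (poly p 0) ([:1, -1:] ^ Suc n) + [:0, 1:] * w"
  have lin: "fps_of_poly [:1, -1 :: real:] = 1 - fps_X"
    by (simp add: fps_of_poly_pCons)
  have X: "fps_of_poly [:0, 1 :: real:] = fps_X"
    by (simp add: fps_of_poly_pCons)
  have "?A p * (1 - fps_X) ^ Suc (Suc n) = (?A p * (1 - fps_X)) * (1 - fps_X) ^ Suc n"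
    by (simp add: mult.assoc)
  also have "\<dots> = fps_const (poly p 0) * (1 - fps_X) ^ Suc n + fps_X * (?A ?q * (1 - fps_X) ^ Suc n)"
    unfolding step by (simp only: distrib_right mult.assoc)
  also have "\<dots> = fps_of_poly ?w"
    unfolding w(2) by (simp only: fps_of_poly_add fps_of_poly_smult fps_of_poly_power fps_of_poly_mult lin X)
  finally have eq: "?A p * (1 - fps_X) ^ Suc (Suc n) = fps_of_poly ?w" .
  have d1: "degree (smult (poly p 0) ([:1, -1:] ^ Suc n)) \<le> Suc n"
    by (rule order.trans[OF degree_smult_le order.trans[OF degree_power_le]]) simp
  have d2: "degree ([:0, 1:] * w) \<le> Suc n"
    by (rule order.trans[OF degree_mult_le]) (use w in simp)
  have "degree ?w \<le> Suc n"
    by (rule degree_add_le[OF d1 d2])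
  with eq show ?case by blast
qed

lemma fps_eq_divide_iff:
  fixes F G :: "real fps"
  shows "F = G / (1 - fps_X) ^ n \<longleftrightarrow> F * (1 - fps_X) ^ n = G"
proof -
  have nz: "fps_nth ((1 - fps_X :: real fps) ^ n) 0 \<noteq> 0"
    by (simp add: fps_power_zeroth)
  then have inv: "inverse ((1 - fps_X :: real fps) ^ n) * (1 - fps_X) ^ n = 1"
    by (rule inverse_mult_eq_1)
  then have inv': "(1 - fps_X :: real fps) ^ n * inverse ((1 - fps_X) ^ n) = 1"
    by (simp only: mult.commute)
  show ?thesis
  proof
    assume "F = G / (1 - fps_X) ^ n"
    then show "F * (1 - fps_X) ^ n = G"
      by (simp only: fps_divide_unit[OF nz] mult.assoc inv mult_1_right)
  next
    assume G: "F * (1 - fps_X) ^ n = G"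
    show "F = G / (1 - fps_X) ^ n"
      unfolding G[symmetric] by (simp only: fps_divide_unit[OF nz] mult.assoc inv' mult_1_right)
  qed
qed

lemma W_poly_ex1:
  "\<exists>!w. degree w \<le> degree p \<and>
     Abs_fps (\<lambda>j. poly p (of_nat j :: real)) = fps_of_poly w / (1 - fps_X) ^ (degree p + 1)"
  using W_poly_exists_aux[OF order.refl, of p]
  unfolding fps_eq_divide_iff by (auto simp: fps_of_poly_eq_iff)

lemma W_poly:
  "degree (W_poly p) \<le> degree p"
  "Abs_fps (\<lambda>j. poly p (of_nat j)) = fps_of_poly (W_poly p) / (1 - fps_X) ^ (degree p + 1)"
  using theI'[OF W_poly_ex1[of p]] unfolding W_poly_def by blast+

lemma poly_eqI_nz:
  fixes p q :: "real poly"
  assumes "\<And>x. x \<noteq> 0 \<Longrightarrow> x \<noteq> 1 \<Longrightarrow> poly p x = poly q x"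
  shows "p = q"
proof (rule ccontr)
  assume "p \<noteq> q"
  then have "finite {x. poly (p - q) x = 0}" by (intro poly_roots_finite) simp
  moreover have "UNIV - {0, 1} \<subseteq> {x. poly (p - q) x = 0}" using assms by auto
  ultimately have "finite (UNIV - {0, 1 :: real})" by (rule rev_finite_subset)
  then show False by (simp add: infinite_UNIV_char_0)
qed

lemma degree_I_poly:
  assumes "degree a \<le> s"
  shows "degree (I_poly s a) \<le> s"
  using assms degree_reflect_poly_le[of a]
    degree_mult_le[of "monom 1 (s - degree a)" "reflect_poly a"]
    degree_monom_le[of "1 :: real" "s - degree a"]
  by (simp add: I_poly_def)

lemma is_symm_decomp_eval:
  assumes "is_symm_decomp d h (a, b)" "x \<noteq> 0"
  shows "(1 - x) * poly a x = poly h x - x * poly (I_poly d h) x"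
    and "poly h x = poly a x + x * poly b x"
proof -
  show h: "poly h x = poly a x + x * poly b x"
    using assms(1) by (auto simp: is_symm_decomp_def)
  have da: "degree a \<le> d" and a: "poly a x = x ^ d * poly a (1 / x)"
    using assms poly_I_poly[of a d x] by (auto simp: is_symm_decomp_def)
  have "degree h \<le> d \<and> poly b x * x = x ^ d * poly b (1 / x)"
  proof (cases d)
    case 0
    then show ?thesis using assms da by (auto simp: is_symm_decomp_def)
  next
    case (Suc e)
    then have b: "degree b \<le> e" "I_poly e b = b" and hh: "h = a + [:0, 1:] * b"
      using assms(1) by (auto simp: is_symm_decomp_def)
    have "degree ([:0, 1:] * b) \<le> d"
      by (rule order.trans[OF degree_mult_le]) (use b Suc in simp)
    then have "degree h \<le> d" unfolding hh using da by (intro degree_add_le)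
    then show ?thesis using poly_I_poly[OF b(1) assms(2)] b(2) Suc by simp
  qed
  then have "poly (I_poly d h) x = x ^ d * poly h (1 / x)"
    and b: "poly b x * x = x ^ d * poly b (1 / x)"
    using poly_I_poly[of h d x] assms(2) by auto
  moreover have "poly h (1 / x) = poly a (1 / x) + poly b (1 / x) / x"
    using assms(1) by (auto simp: is_symm_decomp_def)
  ultimately have "poly (I_poly d h) x = x ^ d * poly a (1 / x) + x ^ d * poly b (1 / x) / x"
    by (simp add: distrib_left)
  also have "\<dots> = poly a x + poly b x"
    unfolding a[symmetric] b[symmetric] using assms(2) by simp
  finally have "poly (I_poly d h) x = poly a x + poly b x" .
  then show "(1 - x) * poly a x = poly h x - x * poly (I_poly d h) x"
    by (simp add: h algebra_simps)
qed

lemma symm_decomp_ex1: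
  assumes dh: "degree h \<le> d"
  shows "\<exists>!ab. is_symm_decomp d h ab"
proof (rule ex_ex1I)
  show "\<exists>ab. is_symm_decomp d h ab"
  proof (cases d)
    case 0
    then have "I_poly 0 h = h"
      using dh by (auto simp: I_poly_def elim!: degree_eq_zeroE)
    then show ?thesis
      using 0 dh by (intro exI[of _ "(h, 0)"]) (simp add: is_symm_decomp_def)
  next
    case (Suc e)
    let ?r = "I_poly d h"
    have r1: "poly ?r 1 = poly h 1" using poly_I_poly[OF dh, of 1] by simp
    have "[:-1, 1:] dvd [:0, 1:] * ?r - h" "[:-1, 1:] dvd h - ?r"
      using r1 by (simp_all add: poly_eq_0_iff_dvd[symmetric])
    then obtain a b where a: "[:0, 1:] * ?r - h = [:-1, 1:] * a"
      and b: "h - ?r = [:-1, 1:] * b" by (auto elim!: dvdE)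
    have ea: "(x - 1) * poly a x = x * poly ?r x - poly h x" for x
      using arg_cong[OF a, of "\<lambda>p. poly p x"] by (simp add: algebra_simps)
    have eb: "(x - 1) * poly b x = poly h x - poly ?r x" for x
      using arg_cong[OF b, of "\<lambda>p. poly p x"] by (simp add: algebra_simps)
    have "degree ([:0, 1:] * ?r) \<le> Suc d"
      by (rule order.trans[OF degree_mult_le]) (use degree_I_poly[OF dh] in simp)
    then have "degree ([:0, 1:] * ?r - h) \<le> Suc d" using dh by (intro degree_diff_le) auto
    then have da: "degree a \<le> d"
      unfolding a by (cases "a = 0") (auto simp: degree_mult_eq simp del: mult_pCons_left)
    have "degree (h - ?r) \<le> d" using dh degree_I_poly[OF dh] by (rule degree_diff_le)
    then have db: "degree b \<le> e"
      unfolding b using Suc by (cases "b = 0") (auto simp: degree_mult_eq simp del: mult_pCons_left)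
    have hab: "h = a + [:0, 1:] * b"
    proof (rule poly_eqI_nz)
      fix x :: real assume "x \<noteq> 0" "x \<noteq> 1"
      have "(x - 1) * poly (a + [:0, 1:] * b) x = (x - 1) * poly a x + x * ((x - 1) * poly b x)"
        by (simp add: algebra_simps)
      then have "(x - 1) * poly h x = (x - 1) * poly (a + [:0, 1:] * b) x"
        unfolding ea eb by (simp add: algebra_simps)
      then show "poly h x = poly (a + [:0, 1:] * b) x" using \<open>x \<noteq> 1\<close> by simp
    qed
    have hx: "poly ?r (1 / x) = poly h x / x ^ d" "poly h (1 / x) = poly ?r x / x ^ d"
      if "x \<noteq> 0" for x
      using poly_I_poly[OF dh, of "1 / x"] poly_I_poly[OF dh that] that
      by (simp_all add: field_simps)
    have "I_poly d a = a"
    proof (rule poly_eqI_nz)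
      fix x :: real assume x: "x \<noteq> 0" "x \<noteq> 1"
      have "(1 / x - 1) * poly a (1 / x) = (1 / x) * (poly h x / x ^ d) - poly ?r x / x ^ d"
        using ea[of "1 / x"] hx[OF x(1)] by simp
      then have "- (x * x ^ d) * ((1 / x - 1) * poly a (1 / x)) = x * poly ?r x - poly h x"
        using x(1) by (simp add: right_diff_distrib)
      moreover have "- (x * x ^ d) * ((1 / x - 1) * poly a (1 / x)) = (x - 1) * (x ^ d * poly a (1 / x))"
        using x(1) by (simp add: left_diff_distrib right_diff_distrib)
      ultimately have "(x - 1) * (x ^ d * poly a (1 / x)) = x * poly ?r x - poly h x"
        by simp
      then have "(x - 1) * (x ^ d * poly a (1 / x)) = (x - 1) * poly a x"
        by (simp add: ea)
      then show "poly (I_poly d a) x = poly a x"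
        using x by (simp add: poly_I_poly[OF da x(1)])
    qed
    moreover have "I_poly e b = b"
    proof (rule poly_eqI_nz)
      fix x :: real assume x: "x \<noteq> 0" "x \<noteq> 1"
      have "(1 / x - 1) * poly b (1 / x) = poly ?r x / x ^ d - poly h x / x ^ d"
        using eb[of "1 / x"] hx[OF x(1)] by simp
      then have "- (x ^ d) * ((1 / x - 1) * poly b (1 / x)) = poly h x - poly ?r x"
        using x(1) by (simp add: right_diff_distrib)
      moreover have "- (x ^ d) * ((1 / x - 1) * poly b (1 / x)) = (x - 1) * (x ^ e * poly b (1 / x))"
        using x(1) Suc by (simp add: left_diff_distrib right_diff_distrib)
      ultimately have "(x - 1) * (x ^ e * poly b (1 / x)) = poly h x - poly ?r x"
        by simp
      then have "(x - 1) * (x ^ e * poly b (1 / x)) = (x - 1) * poly b x"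
        by (simp add: eb)
      then show "poly (I_poly e b) x = poly b x"
        using x by (simp add: poly_I_poly[OF db x(1)])
    qed
    ultimately have "is_symm_decomp d h (a, b)"
      using hab da db Suc unfolding is_symm_decomp_def by simp
    then show ?thesis ..
  qed
next
  fix u v assume uv: "is_symm_decomp d h u" "is_symm_decomp d h v"
  obtain a b a' b' where [simp]: "u = (a, b)" "v = (a', b')" by (cases u, cases v) auto
  have "a = a'"
  proof (rule poly_eqI_nz)
    fix x :: real assume x: "x \<noteq> 0" "x \<noteq> 1"
    then have "(1 - x) * poly a x = (1 - x) * poly a' x"
      using uv is_symm_decomp_eval(1)[of d h _ _ x] by simp
    then show "poly a x = poly a' x" using x by simp
  qed
  moreover have "b = b'"
  proof (rule poly_eqI_nz)
    fix x :: real assume x: "x \<noteq> 0" "x \<noteq> 1"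
    then have "x * poly b x = x * poly b' x"
      using uv \<open>a = a'\<close> is_symm_decomp_eval(2)[of d h a b x] is_symm_decomp_eval(2)[of d h a' b' x]
      by simp
    then show "poly b x = poly b' x" using x by simp
  qed
  ultimately show "u = v" by simp
qed

lemma is_symm_decomp_symm_decomp:
  "degree h \<le> d \<Longrightarrow> is_symm_decomp d h (symm_decomp d h)"
  unfolding symm_decomp_def by (rule theI'[OF symm_decomp_ex1])

end

theory Submission
  imports Defs
begin

text \<open>
  Let \<open>U = 1/(1-X)\<close>, \<open>Y = X U\<^sup>2\<close> and \<open>R = (1+X) U\<close>, so that \<open>R\<^sup>2 = 1 + 4 Y\<close>. If \<open>p\<close> has degree \<open>d\<close> and
  \<open>(a, b)\<close> is the symmetric decomposition of \<open>W(p)\<close>, then the generating function of \<open>p\<close> is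
  \<open>G + X U H\<close> with \<open>G = a U^(d+1)\<close> and \<open>H = b U^d\<close>, and multiplying polynomials means taking the
  Hadamard product \<open>\<odot>\<close> of generating functions. The discrete Leibniz rule gives
  \<open>G \<odot> X U H' = U ((1-X) G \<odot> X U H') + X U (G \<odot> H')\<close>, so the symmetric decomposition of \<open>W(pq)\<close> is a sum
  of Hadamard products with symmetric numerators, each of which can be handled separately.

  Nonnegativity follows because \<open>X^i U^r \<odot> X^j U^s\<close> with \<open>i < r\<close> and \<open>j < s\<close> is a nonnegative combination of the
  \<open>X^k U^(r+s-1)\<close>. For \<open>\<gamma>\<close>-positivity put \<open>T(k,n) = U^e Y^k R^n\<close> with \<open>e \<in> {0,1}\<close> and
  \<open>B(m,l) = T(i,m) \<odot> T(j,l)\<close>. Since \<open>(1-X) T(k,n+1) = (1+X) T(k,n)\<close>, one finds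
  \<open>B(m+1,l+1) + B(m,l) = R (B(m,l+1) + B(m+1,l))\<close>, so \<open>E(m,l) = B(m,l+1) - R B(m,l)\<close> satisfies
  \<open>E(m+1,l) = R E(m,l) + 4 Y B(m,l)\<close>, a recursion with positive coefficients. Its initial values
  are controlled by the operator \<open>\<Theta> = 2 X d/dX + e\<close>: the series \<open>T(j+1,0)\<close> is a positive multiple of
  \<open>(\<Theta>\<^sup>2 - (2j+e)\<^sup>2) T(j,0)\<close>, and this operator preserves positive combinations of the \<open>T(k,n)\<close> with \<open>k \<ge> j\<close>.
\<close>

section \<open>Hadamard products and the Euler operator\<close>

definition hadamard :: "real fps \<Rightarrow> real fps \<Rightarrow> real fps" (infixl "\<odot>" 70) where
  "F \<odot> G = Abs_fps (\<lambda>n. fps_nth F n * fps_nth G n)"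

lemma hadamard_nth [simp]: "fps_nth (F \<odot> G) n = fps_nth F n * fps_nth G n"
  by (simp add: hadamard_def)

lemma hadamard_commute: "F \<odot> G = G \<odot> F"
  by (simp add: fps_eq_iff mult.commute)

lemma hadamard_simps:
  "(F + G) \<odot> H = F \<odot> H + G \<odot> H" "H \<odot> (F + G) = H \<odot> F + H \<odot> G"
  "(F - G) \<odot> H = F \<odot> H - G \<odot> H" "H \<odot> (F - G) = H \<odot> F - H \<odot> G"
  "(fps_const c * F) \<odot> H = fps_const c * (F \<odot> H)" "H \<odot> (fps_const c * F) = fps_const c * (H \<odot> F)"
  "0 \<odot> H = 0" "H \<odot> 0 = 0"
  by (simp_all add: fps_eq_iff algebra_simps)

lemma hadamard_X_X: "(fps_X * F) \<odot> (fps_X * G) = fps_X * (F \<odot> G)"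
  by (simp add: fps_eq_iff)

lemma hadamard_one: "1 \<odot> F = fps_const (fps_nth F 0)"
  by (simp add: fps_eq_iff)

text \<open>Multiplication by \<open>1 - fps_X\<close> is the backward difference of coefficients,
  and f_n g_n - f_(n-1) g_(n-1) = (f_n - f_(n-1)) g_n + f_(n-1) (g_n - g_(n-1)).\<close>

lemma hadamard_Leibniz:
  "(1 - fps_X) * (F \<odot> G) = ((1 - fps_X) * F) \<odot> G + (fps_X * F) \<odot> ((1 - fps_X) * G)"
proof (rule fps_ext)
  fix n show "fps_nth ((1 - fps_X) * (F \<odot> G)) n
    = fps_nth (((1 - fps_X) * F) \<odot> G + (fps_X * F) \<odot> ((1 - fps_X) * G)) n"
    by (cases n) (simp_all add: left_diff_distrib algebra_simps)
qed

text \<open>The hypotheses rearrange to F'_n - F_n = F'_(n-1) + F_(n-1), and likewise for G; the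
  claim is the product of these two equations, expanded and sorted.\<close>

lemma hadamard_product_rule:
  assumes "(1 - fps_X) * F' = (1 + fps_X) * F" "(1 - fps_X) * G' = (1 + fps_X) * G"
  shows "(1 - fps_X) * (F' \<odot> G' + F \<odot> G) = (1 + fps_X) * (F \<odot> G' + F' \<odot> G)"
proof (rule fps_ext)
  fix n
  have F: "fps_nth ((1 - fps_X) * F') n = fps_nth ((1 + fps_X) * F) n"
    and G: "fps_nth ((1 - fps_X) * G') n = fps_nth ((1 + fps_X) * G) n"
    using assms by simp_all
  show "fps_nth ((1 - fps_X) * (F' \<odot> G' + F \<odot> G)) n
      = fps_nth ((1 + fps_X) * (F \<odot> G' + F' \<odot> G)) n"
  proof (cases n)
    case 0
    then show ?thesis using F G by (simp add: distrib_right left_diff_distrib)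
  next
    case (Suc k)
    have F': "fps_nth F' n = fps_nth F' k + fps_nth F n + fps_nth F k"
      and G': "fps_nth G' n = fps_nth G' k + fps_nth G n + fps_nth G k"
      using F G Suc by (simp_all add: distrib_right left_diff_distrib)
    show ?thesis
      using Suc F' G' by (simp add: distrib_right left_diff_distrib) (simp add: algebra_simps)
  qed
qed

text \<open>Being diagonal on coefficients, this operator may be applied to either factor of a
  Hadamard product or to the product itself.\<close>

definition euler_op :: "real fps \<Rightarrow> real fps" where
  "euler_op F = fps_X * fps_deriv F"

lemma euler_op_nth [simp]: "fps_nth (euler_op F) n = of_nat n * fps_nth F n"
  by (cases n) (simp_all add: euler_op_def)

lemma euler_op_simps:
  "euler_op (F + G) = euler_op F + euler_op G" "euler_op (F - G) = euler_op F - euler_op G"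
  "euler_op (fps_const c * F) = fps_const c * euler_op F"
  "euler_op (F * G) = euler_op F * G + F * euler_op G"
  by (simp_all add: euler_op_def algebra_simps)

lemma euler_op_power: "euler_op (F ^ n) = of_nat n * F ^ (n - 1) * euler_op F"
  by (simp add: euler_op_def fps_deriv_power fps_of_nat)

definition fU :: "real fps" where "fU = inverse (1 - fps_X)"

lemma fU_cancel: "(1 - fps_X) * fU = 1"
  unfolding fU_def by (rule inverse_mult_eq_1') simp

lemma fU_nth [simp]: "fps_nth fU n = 1"
proof -
  have "(1 - fps_X) * Abs_fps (\<lambda>_. 1) = (1 :: real fps)"
    by (rule fps_ext) (simp add: left_diff_distrib)
  then have "fU = Abs_fps (\<lambda>_. 1)" using fU_cancel by algebra
  then show ?thesis by (metis fps_nth_Abs_fps)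
qed

definition fY :: "real fps" where "fY = fps_X * fU\<^sup>2"
definition fR :: "real fps" where "fR = (1 + fps_X) * fU"

lemma fR_eq: "fR = 1 + 2 * fps_X * fU"
  using fU_cancel unfolding fR_def by algebra

lemma fR_square: "fR\<^sup>2 = 1 + 4 * fY"
  using fU_cancel unfolding fR_def fY_def by algebra

lemma euler_op_fU: "euler_op fU = fps_X * fU\<^sup>2"
proof -
  have "euler_op ((1 - fps_X) * fU) = 0" unfolding fU_cancel by (simp add: euler_op_def)
  moreover have "euler_op (1 - fps_X) = - fps_X" by (simp add: euler_op_def)
  ultimately have "(1 - fps_X) * euler_op fU = fps_X * fU"
    by (simp add: euler_op_simps)
  then have "fU * ((1 - fps_X) * euler_op fU) = fU * (fps_X * fU)" by simp
  then show ?thesis using fU_cancel by algebra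
qed

lemma euler_op_X: "euler_op fps_X = fps_X"
  by (simp add: euler_op_def)

lemma euler_op_fY: "euler_op fY = fY * fR"
proof -
  have "euler_op fY = fps_X * fU\<^sup>2 + fps_X * (2 * fU * (fps_X * fU\<^sup>2))"
    unfolding fY_def power2_eq_square by (simp add: euler_op_simps euler_op_fU euler_op_X) (simp add: algebra_simps power2_eq_square)
  then show ?thesis unfolding fY_def fR_eq by algebra
qed

lemma euler_op_fR: "euler_op fR = 2 * fY"
proof -
  have "euler_op (1 + fps_X) = fps_X" by (simp add: euler_op_def)
  then have "euler_op fR = fps_X * fU + (1 + fps_X) * (fps_X * fU\<^sup>2)"
    unfolding fR_def by (simp add: euler_op_simps euler_op_fU)
  then show ?thesis using fU_cancel unfolding fY_def by algebra
qed

text \<open>A palindromic numerator \<open>x^k (1+x)^n\<close> appears over \<open>(1-x)^(2k+n+e)\<close>: the case \<open>e = 1\<close> is that of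
  polynomials symmetric about \<open>-1/2\<close>, the case \<open>e = 0\<close> that of polynomials symmetric about \<open>0\<close>.\<close>

definition fT :: "nat \<Rightarrow> nat \<Rightarrow> nat \<Rightarrow> real fps" where
  "fT e k n = fU ^ e * fY ^ k * fR ^ n"

text \<open>The eigenvalue at index n is 2n + e, twice the distance from the centre of symmetry
  -e/2.\<close>

definition tw_euler :: "nat \<Rightarrow> real fps \<Rightarrow> real fps" where
  "tw_euler e F = 2 * euler_op F + of_nat e * F"

lemma tw_euler_nth [simp]: "fps_nth (tw_euler e F) n = (2 * of_nat n + of_nat e) * fps_nth F n"
  by (simp add: tw_euler_def algebra_simps numeral_fps_const flip: fps_of_nat)

lemma tw_euler_fR: "tw_euler e (fR * F) = fR * tw_euler e F + 4 * fY * F"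
  by (simp add: tw_euler_def euler_op_simps euler_op_fR algebra_simps)

text \<open>\<open>euler_op\<close> is a derivation sending Y to Y R and R to 2 Y, while
  \<open>tw_euler\<close> sends U^e to e U^e R. At n = 0 the truncated \<open>n - 1\<close> is
  harmless, as its coefficient is 0.\<close>

lemma tw_euler_fT:
  "tw_euler e (fT e k n) = of_nat (2 * k + e) * fT e k (n + 1) + of_nat (4 * n) * fT e (k + 1) (n - 1)"
proof -
  have U: "2 * euler_op (fU ^ e) + of_nat e * fU ^ e = of_nat e * fU ^ e * fR"
    unfolding euler_op_power euler_op_fU fR_eq
    by (cases e) (simp_all add: algebra_simps power2_eq_square)
  have Y: "euler_op (fY ^ k) = of_nat k * fY ^ k * fR"
    unfolding euler_op_power euler_op_fY by (cases k) (simp_all add: algebra_simps)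
  have "tw_euler e (fT e k n) = (2 * euler_op (fU ^ e) + of_nat e * fU ^ e) * fY ^ k * fR ^ n
     + 2 * fU ^ e * euler_op (fY ^ k) * fR ^ n + 2 * fU ^ e * fY ^ k * euler_op (fR ^ n)"
    by (simp add: tw_euler_def fT_def euler_op_simps algebra_simps)
  then show ?thesis unfolding U Y
    by (simp add: fT_def euler_op_power euler_op_fR algebra_simps)
qed

lemma fR_fT: "fR * fT e k n = fT e k (n + 1)"
  by (simp add: fT_def algebra_simps)

lemma fY_fT: "fY * fT e k n = fT e (k + 1) n"
  by (simp add: fT_def algebra_simps)

lemma fT_add_2: "fT e k (n + 2) = fT e k n + 4 * fT e (k + 1) n"
proof -
  have "fT e k (n + 2) = fU ^ e * fY ^ k * fR ^ n * fR\<^sup>2" by (simp add: fT_def power2_eq_square mult.assoc)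
  then show ?thesis unfolding fR_square by (simp add: fT_def algebra_simps)
qed

lemma tw_euler_simps:
  "tw_euler e (F + G) = tw_euler e F + tw_euler e G"
  "tw_euler e (F - G) = tw_euler e F - tw_euler e G"
  "tw_euler e (fps_const c * F) = fps_const c * tw_euler e F"
  "tw_euler e (of_nat n * F) = of_nat n * tw_euler e F"
  by (simp_all add: fps_eq_iff algebra_simps flip: fps_of_nat)

text \<open>Coefficient n is multiplied by 4 (n - j) (n + j + e). For 2j + e > 0 the coefficients of
  \<open>fT e j 0\<close> are binom(n+j+e-1, 2j+e-1), and up to a constant these are the two factors
  missing from the binomial for j + 1.\<close>

definition quad_euler :: "nat \<Rightarrow> nat \<Rightarrow> real fps \<Rightarrow> real fps" where
  "quad_euler e j F = tw_euler e (tw_euler e F) - of_nat ((2 * j + e)\<^sup>2) * F"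

lemma quad_euler_fT:
  assumes "j \<le> k"
  shows "quad_euler e j (fT e k n) = of_nat ((2 * k + e)\<^sup>2 - (2 * j + e)\<^sup>2) * fT e k (n + 2)
    + of_nat (4 * ((2 * k + e) * (n + 1) + n * (2 * k + 2 + e) + (2 * j + e)\<^sup>2)) * fT e (k + 1) n
    + of_nat (16 * n * (n - 1)) * fT e (k + 2) (n - 2)"
proof -
  have le: "(2 * j + e)\<^sup>2 \<le> (2 * k + e)\<^sup>2" using assms by (intro power_mono) auto
  have "tw_euler e (tw_euler e (fT e k n))
      = of_nat ((2 * k + e)\<^sup>2) * fT e k (n + 2)
        + of_nat (4 * ((2 * k + e) * (n + 1) + n * (2 * k + 2 + e))) * fT e (k + 1) n
        + of_nat (16 * n * (n - 1)) * fT e (k + 2) (n - 2)"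
    unfolding tw_euler_fT tw_euler_simps
    by (cases n) (simp_all add: algebra_simps power2_eq_square)
  \<comment> \<open>R^2 = 1 + 4 Y moves the subtraction onto \<open>fT e k (n + 2)\<close>, whose
    coefficient becomes (2k+e)^2 - (2j+e)^2: nonnegative for j \<le> k and zero at k = j.\<close>
  moreover have "fT e k n = fT e k (n + 2) - 4 * fT e (k + 1) n"
    unfolding fT_add_2 by simp
  ultimately have "quad_euler e j (fT e k n) = of_nat ((2 * k + e)\<^sup>2) * fT e k (n + 2)
        + of_nat (4 * ((2 * k + e) * (n + 1) + n * (2 * k + 2 + e))) * fT e (k + 1) n
        + of_nat (16 * n * (n - 1)) * fT e (k + 2) (n - 2)
        - of_nat ((2 * j + e)\<^sup>2) * (fT e k (n + 2) - 4 * fT e (k + 1) n)"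
    unfolding quad_euler_def by metis
  then show ?thesis
    unfolding of_nat_diff[OF le] of_nat_add of_nat_mult by (simp add: algebra_simps)
qed

section \<open>Cones of power series\<close>

text \<open>The coefficient set \<open>S\<close> will be either the nonnegative reals, expressing \<open>\<gamma>\<close>-positivity, or all
  reals, expressing only that the numerator is palindromic.\<close>

inductive_set lcone :: "real set \<Rightarrow> real fps set \<Rightarrow> real fps set" for S A where
  zero: "0 \<in> lcone S A"
| step: "c \<in> S \<Longrightarrow> t \<in> A \<Longrightarrow> f \<in> lcone S A \<Longrightarrow> fps_const c * t + f \<in> lcone S A"

lemma lcone_add: "f \<in> lcone S A \<Longrightarrow> g \<in> lcone S A \<Longrightarrow> f + g \<in> lcone S A"
  by (induction rule: lcone.induct) (auto simp: add.assoc intro: lcone.step)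

lemma lcone_sum: "(\<And>i. i \<in> I \<Longrightarrow> f i \<in> lcone S A) \<Longrightarrow> sum f I \<in> lcone S A"
  by (induction I rule: infinite_finite_induct) (auto intro: lcone.zero lcone_add)

lemma lcone_base: "c \<in> S \<Longrightarrow> t \<in> A \<Longrightarrow> fps_const c * t \<in> lcone S A"
  using lcone.step[OF _ _ lcone.zero] by force

lemma lcone_scale:
  assumes "f \<in> lcone S A" "c \<in> S" "S = UNIV \<or> S = {0..}"
  shows "fps_const c * f \<in> lcone S A"
  using assms(1)
proof (induction rule: lcone.induct)
  case zero then show ?case by (simp add: lcone.zero)
next
  case (step d t f)
  then have "fps_const (c * d) * t + fps_const c * f \<in> lcone S A"
    using assms by (intro lcone.step) auto
  then show ?case by (simp add: distrib_left mult.assoc flip: fps_const_mult)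
qed

lemma lcone_mono:
  assumes "f \<in> lcone S A" "S \<subseteq> S'" "A \<subseteq> A'" shows "f \<in> lcone S' A'"
  using assms(1) by (induction rule: lcone.induct) (use assms in \<open>auto intro: lcone.intros\<close>)

lemma lcone_map:
  assumes f: "f \<in> lcone S A"
    and S: "S = UNIV \<or> S = {0..}"
    and L: "\<And>c f g. L (fps_const c * f + g) = fps_const c * L f + L g"
    and T: "\<And>t. t \<in> A \<Longrightarrow> L t \<in> lcone S B"
  shows "L f \<in> lcone S B"
  using f
proof (induction rule: lcone.induct)
  case zero
  have "L 0 = 0" using L[of 1 0 0] by simp
  then show ?case by (simp add: lcone.zero)
next
  case (step c k f)
  then show ?case unfolding L using T S by (intro lcone_add lcone_scale) auto
qed

lemma lcone_map_mult:
  assumes "f \<in> lcone S A" "S = UNIV \<or> S = {0..}" "\<And>t. t \<in> A \<Longrightarrow> h * t \<in> B"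
  shows "h * f \<in> lcone S B"
  using assms(1,2)
proof (rule lcone_map[where L = "\<lambda>f. h * f"])
  fix t assume "t \<in> A"
  then show "h * t \<in> lcone S B" using lcone_base[of 1 S "h * t" B] assms by auto
qed (simp add: algebra_simps)

text \<open>\<open>r\<close> is the exponent of the denominator, and \<open>K\<close> bounds from
  below the power of X dividing the numerator.\<close>

definition fT_set :: "nat \<Rightarrow> nat \<Rightarrow> nat \<Rightarrow> real fps set" where
  "fT_set e K r = {fT e k n | k n. K \<le> k \<and> 2 * k + n + e = r}"

abbreviation gcone :: "nat \<Rightarrow> real set \<Rightarrow> nat \<Rightarrow> nat \<Rightarrow> real fps set" where
  "gcone e S K r \<equiv> lcone S (fT_set e K r)"

abbreviation pcone :: "nat \<Rightarrow> nat \<Rightarrow> nat \<Rightarrow> real fps set" where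
  "pcone e K r \<equiv> gcone e {0..} K r"

lemma fT_setI: "K \<le> k \<Longrightarrow> 2 * k + n + e = r \<Longrightarrow> fT e k n \<in> fT_set e K r"
  by (auto simp: fT_set_def)

lemma fT_setE:
  assumes "t \<in> fT_set e K r"
  obtains k n where "t = fT e k n" "K \<le> k" "2 * k + n + e = r"
  using assms by (auto simp: fT_set_def)

lemma gcone_mono: "f \<in> gcone e S K r \<Longrightarrow> S \<subseteq> S' \<Longrightarrow> K' \<le> K \<Longrightarrow> f \<in> gcone e S' K' r"
  by (erule lcone_mono) (auto elim!: fT_setE intro!: fT_setI)

text \<open>The alternative \<open>m = 0\<close> discards the terms whose exponent
  \<open>n - 1\<close> or \<open>n - 2\<close> was truncated.\<close>

lemma pcone_fT: "(m = 0 \<or> K \<le> k \<and> 2 * k + n + e = r) \<Longrightarrow> of_nat m * fT e k n \<in> pcone e K r"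
  using lcone_base[of "real m" "{0..}" "fT e k n"] lcone.zero fT_setI by (auto simp: fps_of_nat)

lemma pcone_numeral: "f \<in> pcone e K r \<Longrightarrow> numeral m * f \<in> pcone e K r"
  using lcone_scale[of f "{0..}" _ "numeral m"] by (simp add: numeral_fps_const)

lemma gcone_fR: "f \<in> gcone e S K r \<Longrightarrow> S = UNIV \<or> S = {0..} \<Longrightarrow> fR * f \<in> gcone e S K (r + 1)"
  by (erule lcone_map_mult) (auto simp only: fR_fT elim!: fT_setE intro!: fT_setI)

lemma gcone_fY: "f \<in> gcone e S K r \<Longrightarrow> S = UNIV \<or> S = {0..} \<Longrightarrow> fY * f \<in> gcone e S (K + 1) (r + 2)"
  by (erule lcone_map_mult) (assumption, elim fT_setE, simp only: fY_fT, rule fT_setI, auto)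

lemma pcone_tw_euler:
  assumes "f \<in> pcone e K r" shows "tw_euler e f \<in> pcone e K (r + 1)"
  using assms
proof (rule lcone_map[where L = "tw_euler e"])
  fix t assume "t \<in> fT_set e K r"
  then obtain k n where t: "t = fT e k n" "K \<le> k" "2 * k + n + e = r" by (auto simp: fT_set_def)
  then show "tw_euler e t \<in> pcone e K (r + 1)"
    unfolding t(1) tw_euler_fT by (intro lcone_add pcone_fT) auto
qed (auto simp: tw_euler_simps)

text \<open>The leading term drops out at k = j, so every surviving generator has index at least j +
  1.\<close>

lemma pcone_quad_euler:
  assumes "f \<in> pcone e j r" shows "quad_euler e j f \<in> pcone e (j + 1) (r + 2)"
  using assms
proof (rule lcone_map[where L = "quad_euler e j"])
  fix c f g show "quad_euler e j (fps_const c * f + g) = fps_const c * quad_euler e j f + quad_euler e j g"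
    by (simp add: quad_euler_def algebra_simps fps_eq_iff flip: fps_of_nat)
next
  fix t assume "t \<in> fT_set e j r"
  then obtain k n where t: "t = fT e k n" and k: "j \<le> k" "2 * k + n + e = r" by (auto simp: fT_set_def)
  then have "k = j \<or> j + 1 \<le> k" by auto
  with k show "quad_euler e j t \<in> pcone e (j + 1) (r + 2)"
    unfolding t quad_euler_fT[OF k(1)]
    by (intro lcone_add pcone_fT) (auto simp: le_Suc_eq)
qed auto

section \<open>Products of gamma-positive series\<close>

lemma hadamard_quad_euler: "F \<odot> quad_euler e j G = quad_euler e j (F \<odot> G)"
  by (simp add: quad_euler_def fps_eq_iff algebra_simps flip: fps_of_nat)

lemma quad_euler_fT_step:
  "quad_euler e j (fT e j 0) = of_nat (4 * ((2 * j + e) + (2 * j + e)\<^sup>2)) * fT e (j + 1) 0"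
  unfolding quad_euler_fT[OF order.refl] by simp

lemma quad_euler_fR:
  "quad_euler e j (fR * F) = fR * quad_euler e j F + 4 * tw_euler e (fY * F) + 4 * (fY * tw_euler e F)"
proof -
  have "tw_euler e (4 * fY * F) = 4 * tw_euler e (fY * F)"
    using tw_euler_simps(4)[of e 4 "fY * F"] by (simp add: mult.assoc)
  then show ?thesis
    unfolding quad_euler_def tw_euler_fR tw_euler_simps by (simp add: algebra_simps)
qed

lemma hadamard_fU [simp]: "F \<odot> fU = F"
  by (simp add: fps_eq_iff)

text \<open>The difference in the second part passes from \<open>j\<close> to \<open>j + 1\<close> because the commutator of
  \<open>\<Theta>\<^sup>2\<close> with multiplication by \<open>R\<close> is \<open>4 \<Theta> Y + 4 Y \<Theta>\<close>, a positive operator.\<close>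

lemma hadamard_fT_0:
  assumes e: "e \<le> 1" and j: "1 - e \<le> j"
  shows "fT e i m \<odot> fT e j 0 \<in> pcone e j (2 * i + m + 2 * j + 2 * e - 1) \<and>
    fT e i (m + 1) \<odot> fT e j 0 - fR * (fT e i m \<odot> fT e j 0) \<in> pcone e j (2 * i + m + 2 * j + 2 * e)"
  using j
proof (induction j rule: dec_induct)
  case base
  show ?case
  proof (cases "e = 0")
    case True
    \<comment> \<open>The n-th coefficient of Y is n, which is half the eigenvalue of
      \<open>tw_euler 0\<close>.\<close>
    have Y: "F \<odot> fT 0 1 0 = fps_const (1/2) * tw_euler 0 F" for F
    proof -
      have "fT 0 1 0 = euler_op fU" by (simp add: fT_def fY_def euler_op_fU)
      then show ?thesis by (simp add: fps_eq_iff)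
    qed
    have "tw_euler 0 (fT 0 i m) \<in> pcone 0 1 (2 * i + m + 1)"
      unfolding tw_euler_fT by (intro lcone_add pcone_fT) auto
    then have 1: "fT 0 i m \<odot> fT 0 1 0 \<in> pcone 0 1 (2 * i + m + 1)"
      unfolding Y by (intro lcone_scale) auto
    have "fT 0 i (m + 1) \<odot> fT 0 1 0 - fR * (fT 0 i m \<odot> fT 0 1 0) = fps_const (1/2) * (4 * (fY * fT 0 i m))"
      unfolding Y fR_fT[symmetric] tw_euler_fR by (simp add: algebra_simps)
    also have "\<dots> = fps_const (1/2) * (of_nat 4 * fT 0 (i + 1) m)" unfolding fY_fT by simp
    also have "\<dots> \<in> pcone 0 1 (2 * i + m + 2)" by (intro lcone_scale pcone_fT) auto
    finally show ?thesis using 1 True by (simp add: eval_nat_numeral)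
  next
    case False
    then have e1: "e = 1" using e by simp
    \<comment> \<open>U is the unit of the Hadamard product, so here the difference is exactly
      0.\<close>
    have "fT 1 0 0 = fU" by (simp add: fT_def)
    moreover have "fT 1 i m \<in> pcone 1 0 (2 * i + m + 1)"
      using pcone_fT[of 1 0 i m 1] by simp
    ultimately show ?thesis using e1 by (simp add: fR_fT[simplified] lcone.zero)
  qed
next
  case (step j)
  let ?c = "4 * ((2 * j + e) + (2 * j + e)\<^sup>2)"
  \<comment> \<open>This rests on 2j + e > 0, which is why the induction starts at j = 1 when e =
    0.\<close>
  have c: "?c > 0" using step.hyps e by auto
  have "fT e (j + 1) 0 = fps_const (1 / real ?c) * (fps_const (real ?c) * fT e (j + 1) 0)"
    using c by (simp add: fps_eq_iff del: of_nat_add of_nat_mult)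
  then have T: "fT e (j + 1) 0 = fps_const (1 / real ?c) * quad_euler e j (fT e j 0)"
    unfolding quad_euler_fT_step fps_of_nat .
  have TQ: "F \<odot> fT e (j + 1) 0 = fps_const (1 / real ?c) * quad_euler e j (F \<odot> fT e j 0)" for F
    unfolding T hadamard_simps hadamard_quad_euler ..
  let ?A = "fT e i m \<odot> fT e j 0" and ?A' = "fT e i (m + 1) \<odot> fT e j 0"
  let ?r = "2 * i + m + 2 * j + 2 * e - 1"
  have r: "2 * i + m + 2 * j + 2 * e = ?r + 1" using step.hyps e by auto
  have A: "?A \<in> pcone e j ?r" and D: "?A' - fR * ?A \<in> pcone e j (?r + 1)"
    using step.IH r by simp_all
  have 1: "fT e i m \<odot> fT e (j + 1) 0 \<in> pcone e (j + 1) (?r + 2)"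
    unfolding TQ by (intro lcone_scale pcone_quad_euler A) auto
  have "quad_euler e j ?A' - fR * quad_euler e j ?A
    = quad_euler e j (?A' - fR * ?A) + (quad_euler e j (fR * ?A) - fR * quad_euler e j ?A)"
    by (simp add: quad_euler_def tw_euler_simps algebra_simps)
  also have "\<dots> = quad_euler e j (?A' - fR * ?A) + (4 * tw_euler e (fY * ?A) + 4 * (fY * tw_euler e ?A))"
    unfolding quad_euler_fR by (simp add: algebra_simps)
  also have "\<dots> \<in> pcone e (j + 1) (?r + 3)"
  proof (intro lcone_add pcone_numeral)
    show "quad_euler e j (?A' - fR * ?A) \<in> pcone e (j + 1) (?r + 3)"
      using pcone_quad_euler[OF D] by (simp add: eval_nat_numeral)
    show "tw_euler e (fY * ?A) \<in> pcone e (j + 1) (?r + 3)"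
      using pcone_tw_euler[OF gcone_fY[OF A]] by (simp add: eval_nat_numeral)
    show "fY * tw_euler e ?A \<in> pcone e (j + 1) (?r + 3)"
      using gcone_fY[OF pcone_tw_euler[OF A]] by (simp add: eval_nat_numeral)
  qed
  finally have "fps_const (1 / real ?c) * (quad_euler e j ?A' - fR * quad_euler e j ?A) \<in> pcone e (j + 1) (?r + 3)"
    by (rule lcone_scale) auto
  moreover have "fps_const (1 / real ?c) * (quad_euler e j ?A' - fR * quad_euler e j ?A)
      = fT e i (m + 1) \<odot> fT e (j + 1) 0 - fR * (fT e i m \<odot> fT e (j + 1) 0)"
    unfolding TQ by (simp add: right_diff_distrib mult.left_commute)
  ultimately have 2: "fT e i (m + 1) \<odot> fT e (j + 1) 0 - fR * (fT e i m \<odot> fT e (j + 1) 0) \<in> pcone e (j + 1) (?r + 3)"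
    by (simp only:)
  have "2 * i + m + 2 * (j + 1) + 2 * e - 1 = ?r + 2" "2 * i + m + 2 * (j + 1) + 2 * e = ?r + 3"
    using r by auto
  with 1 2 show ?case by (simp only: Suc_eq_plus1)
qed

lemma fT_hadamard_rec:
  "fT e i (m + 1) \<odot> fT e j (l + 1) - fR * (fT e i (m + 1) \<odot> fT e j l)
   = fR * (fT e i m \<odot> fT e j (l + 1) - fR * (fT e i m \<odot> fT e j l)) + 4 * (fY * (fT e i m \<odot> fT e j l))"
proof -
  let ?B = "\<lambda>m l. fT e i m \<odot> fT e j l"
  have T: "(1 - fps_X) * fT e k (n + 1) = (1 + fps_X) * fT e k n" for k n
    using fU_cancel unfolding fR_fT[symmetric] fR_def by algebra
  have "(1 - fps_X) * (?B (m + 1) (l + 1) + ?B m l) = (1 + fps_X) * (?B m (l + 1) + ?B (m + 1) l)"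
    by (rule hadamard_product_rule[OF T T])
  then have "fU * ((1 - fps_X) * (?B (m + 1) (l + 1) + ?B m l)) = fR * (?B m (l + 1) + ?B (m + 1) l)"
    unfolding fR_def by algebra
  then have "?B (m + 1) (l + 1) + ?B m l = fR * (?B m (l + 1) + ?B (m + 1) l)"
    using fU_cancel by algebra
  \<comment> \<open>Isolating B(m+1,l+1) leaves -B(m,l); splitting off R^2 B(m,l) turns this into
    (R^2 - 1) B(m,l) = 4 Y B(m,l).\<close>
  then show ?thesis using fR_square by algebra
qed

text \<open>Induction on m carries both B(m,l) and E(m,l) = B(m,l+1) - R B(m,l) for all l: E
  advances by its recursion, and B(m,l) is rebuilt from B(m,0) by adding differences.\<close>

lemma hadamard_fT:
  assumes e: "e \<le> 1" and j: "1 - e \<le> j"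
  shows "fT e i m \<odot> fT e j l \<in> pcone e (1 - e) (2 * i + m + 2 * j + l + 2 * e - 1)"
proof -
  define B where "B m l = fT e i m \<odot> fT e j l" for m l
  define t where "t = 2 * i + 2 * j + 2 * e - 1"
  have t: "2 * i + 2 * j + 2 * e = t + 1" using e j unfolding t_def by auto
  have Bm0: "B m 0 \<in> pcone e (1 - e) (t + m)" for m
  proof -
    have "2 * i + m + 2 * j + 2 * e - 1 = t + m" using t by auto
    then show ?thesis using hadamard_fT_0[OF e j, of i m] gcone_mono[OF _ order.refl j]
      unfolding B_def by auto
  qed
  have E0: "B 0 (l + 1) - fR * B 0 l \<in> pcone e (1 - e) (t + l + 1)" for l
  proof (cases "1 - e \<le> i")
    case True
    \<comment> \<open>\<open>i\<close> is also large enough here, so E(0,l) is covered by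
      \<open>hadamard_fT_0\<close> with the two factors exchanged.\<close>
    have "2 * j + l + 2 * i + 2 * e = t + l + 1" using t by auto
    then have "B 0 (l + 1) - fR * B 0 l \<in> pcone e i (t + l + 1)"
      using hadamard_fT_0[OF e True, of j l] unfolding B_def hadamard_commute[of "fT e i 0"] by argo
    then show ?thesis using gcone_mono[OF _ order.refl True] by blast
  next
    case False
    \<comment> \<open>The first factor is then 1 and the second has no constant term, so their
      product vanishes.\<close>
    then have "e = 0" "i = 0" "j \<ge> 1" using e j by auto
    then have "fT e i 0 = 1" "fps_nth (fT e j l) 0 = 0" for l
      by (auto simp: fT_def fY_def fps_nth_power_0)
    then have "B 0 l = 0" for l unfolding B_def by (simp add: hadamard_one)
    then show ?thesis by (simp add: lcone.zero)
  qed
  have "(\<forall>l. B m (l + 1) - fR * B m l \<in> pcone e (1 - e) (t + m + l + 1)) \<and>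
        (\<forall>l. B m l \<in> pcone e (1 - e) (t + m + l))"
  proof (induction m)
    case 0
    have "B 0 l \<in> pcone e (1 - e) (t + l)" for l
    proof (induction l)
      case 0 then show ?case using Bm0[of 0] by simp
    next
      case (Suc l)
      have "(B 0 (l + 1) - fR * B 0 l) + fR * B 0 l \<in> pcone e (1 - e) (t + l + 1)"
        using E0 Suc by (intro lcone_add gcone_fR) auto
      then show ?case by simp
    qed
    then show ?case using E0 by simp
  next
    case (Suc m)
    have E: "B (Suc m) (l + 1) - fR * B (Suc m) l \<in> pcone e (1 - e) (t + Suc m + l + 1)" for l
    proof -
      have 1: "fR * (B m (l + 1) - fR * B m l) \<in> pcone e (1 - e) (t + Suc m + l + 1)"
        using gcone_fR[of "B m (l + 1) - fR * B m l" "{0..}" e "1 - e" "t + m + l + 1"] Suc by simp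
      have "fY * B m l \<in> pcone e (1 - e + 1) (t + m + l + 2)"
        using Suc by (intro gcone_fY) auto
      then have 2: "fY * B m l \<in> pcone e (1 - e) (t + Suc m + l + 1)"
        using gcone_mono[of _ "{0..}" e "1 - e + 1"] by auto
      show ?thesis using lcone_add[OF 1 pcone_numeral[OF 2, of "num.Bit0 (num.Bit0 num.One)"]]
        unfolding B_def using fT_hadamard_rec[of e i m j l] by simp
    qed
    have "B (Suc m) l \<in> pcone e (1 - e) (t + Suc m + l)" for l
    proof (induction l)
      case 0 then show ?case using Bm0[of "Suc m"] by simp
    next
      case (Suc l)
      have "(B (Suc m) (l + 1) - fR * B (Suc m) l) + fR * B (Suc m) l \<in> pcone e (1 - e) (t + Suc m + l + 1)"
        using E[of l] Suc by (intro lcone_add gcone_fR) auto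
      then show ?case by simp
    qed
    then show ?case using E by blast
  qed
  moreover have "2 * i + m + 2 * j + l + 2 * e - 1 = t + m + l" using t by auto
  ultimately show ?thesis unfolding B_def by auto
qed

text \<open>By bilinearity generators suffice; their products lie in the positive cone, hence in the
  cone for either choice of \<open>S\<close>.\<close>

lemma gcone_hadamard:
  assumes f: "f \<in> gcone e S K r" and g: "g \<in> gcone e S K' s"
    and e: "e \<le> 1" "1 - e \<le> K'" and S: "S = UNIV \<or> S = {0..}"
  shows "f \<odot> g \<in> gcone e S (1 - e) (r + s - 1)"
  using f S
proof (rule lcone_map[where L = "\<lambda>f. f \<odot> g"])
  fix t assume "t \<in> fT_set e K r"
  then obtain i m where t: "t = fT e i m" "2 * i + m + e = r" by (auto simp: fT_set_def)
  from g S show "t \<odot> g \<in> gcone e S (1 - e) (r + s - 1)"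
  proof (rule lcone_map[where L = "\<lambda>g. t \<odot> g"])
    fix u assume "u \<in> fT_set e K' s"
    then obtain j l where u: "u = fT e j l" "2 * j + l + e = s" "K' \<le> j" by (auto simp: fT_set_def)
    have "2 * i + m + 2 * j + l + 2 * e - 1 = r + s - 1" using t u by auto
    then have "t \<odot> u \<in> pcone e (1 - e) (r + s - 1)"
      unfolding t u using hadamard_fT[of e j i m l] e u by simp
    then show "t \<odot> u \<in> gcone e S (1 - e) (r + s - 1)"
      by (rule gcone_mono) (use S in auto)
  qed (simp add: hadamard_simps)
qed (simp add: hadamard_simps)

section \<open>Passing between the two centres of symmetry\<close>

lemma gcone_1_imp_0:
  assumes "f \<in> gcone 1 S K (r + 1)" "S = UNIV \<or> S = {0..}"
  shows "(1 - fps_X) * f \<in> gcone 0 S K r"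
  using assms
proof (rule lcone_map_mult)
  fix t assume "t \<in> fT_set 1 K (r + 1)"
  then show "(1 - fps_X) * t \<in> fT_set 0 K r"
  proof (rule fT_setE)
    fix k n assume t: "t = fT 1 k n" "K \<le> k" "2 * k + n + 1 = r + 1"
    have "(1 - fps_X) * t = fT 0 k n"
      using fU_cancel unfolding t fT_def by (simp flip: mult.assoc)
    then show ?thesis using t by (auto intro: fT_setI)
  qed
qed

lemma gcone_0_imp_1:
  assumes "f \<in> gcone 0 S K r" "S = UNIV \<or> S = {0..}"
  shows "fU * f \<in> gcone 1 S 0 (r + 1)"
  using assms
proof (rule lcone_map_mult)
  fix t assume "t \<in> fT_set 0 K r"
  then show "fU * t \<in> fT_set 1 0 (r + 1)"
  proof (rule fT_setE)
    fix k n assume t: "t = fT 0 k n" "K \<le> k" "2 * k + n + 0 = r"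
    have "fU * t = fT 1 k n" unfolding t fT_def by (simp flip: mult.assoc)
    then show ?thesis using t by (auto intro: fT_setI)
  qed
qed

lemma XU_fT: "fps_X * fU * fT 1 k n = fT 0 (k + 1) n"
  unfolding fT_def fY_def by (simp add: power2_eq_square mult_ac power_mult_distrib)

lemma gcone_XU:
  assumes "f \<in> gcone 1 S 0 r" "S = UNIV \<or> S = {0..}"
  shows "fps_X * fU * f \<in> gcone 0 S 1 (r + 1)"
  using assms
proof (rule lcone_map_mult)
  fix t assume "t \<in> fT_set 1 0 r"
  then show "fps_X * fU * t \<in> fT_set 0 1 (r + 1)"
    by (rule fT_setE) (simp only: XU_fT, rule fT_setI, auto)
qed

text \<open>Each generator with k \<ge> 1 is X U times a generator for e = 1, and X U is not a zero
  divisor.\<close>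

lemma gcone_XU_cancel:
  assumes "fps_X * fU * f \<in> gcone 0 S 1 (r + 1)"
  shows "f \<in> gcone 1 S 0 r"
proof -
  have "g \<in> gcone 0 S 1 (r + 1) \<Longrightarrow> \<exists>f \<in> gcone 1 S 0 r. g = fps_X * fU * f" for g
  proof (induction rule: lcone.induct)
    case zero then show ?case by (auto intro: bexI[of _ 0] lcone.zero)
  next
    case (step c t g)
    from \<open>t \<in> fT_set 0 1 (r + 1)\<close> obtain k n where t: "t = fT 0 k n" "1 \<le> k" "2 * k + n + 0 = r + 1"
      by (rule fT_setE)
    obtain f where f: "f \<in> gcone 1 S 0 r" "g = fps_X * fU * f" using step.IH by blast
    have "fps_const c * t + g = fps_X * fU * (fps_const c * fT 1 (k - 1) n + f)"
      using XU_fT[of "k - 1" n] t f(2) by (simp add: algebra_simps)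
    moreover have "fps_const c * fT 1 (k - 1) n + f \<in> gcone 1 S 0 r"
      using t step f by (intro lcone.step fT_setI) auto
    ultimately show ?case by blast
  qed
  then obtain g where g: "g \<in> gcone 1 S 0 r" "fps_X * fU * f = fps_X * fU * g" using assms by blast
  have "fU \<noteq> 0" using fU_cancel by auto
  then have "fps_X * fU \<noteq> 0" by simp
  then have "f = g" using g(2) by simp
  then show ?thesis using g by simp
qed

text \<open>The even and odd parts are the symmetric parts \<open>a\<close> and \<open>b\<close> of the product, divided by the appropriate
  powers of \<open>1 - X\<close>.\<close>

definition prod_even :: "real fps \<Rightarrow> real fps \<Rightarrow> real fps \<Rightarrow> real fps \<Rightarrow> real fps" where
  "prod_even G H G' H' = G \<odot> G' + fU * (((1 - fps_X) * G) \<odot> (fps_X * fU * H'))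
     + fU * ((fps_X * fU * H) \<odot> ((1 - fps_X) * G'))"

definition prod_odd :: "real fps \<Rightarrow> real fps \<Rightarrow> real fps \<Rightarrow> real fps \<Rightarrow> real fps" where
  "prod_odd G H G' H' = G \<odot> H' + H \<odot> G' + (1 - fps_X) * ((fU * H) \<odot> (fU * H'))"

lemma hadamard_cross:
  "G \<odot> (fps_X * fU * H) = fU * (((1 - fps_X) * G) \<odot> (fps_X * fU * H)) + fps_X * fU * (G \<odot> H)"
proof -
  have "(1 - fps_X) * (fps_X * fU * H) = fps_X * H" using fU_cancel by algebra
  then have "(1 - fps_X) * (G \<odot> (fps_X * fU * H))
      = ((1 - fps_X) * G) \<odot> (fps_X * fU * H) + fps_X * (G \<odot> H)"
    unfolding hadamard_Leibniz[of G] by (simp only: hadamard_X_X)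
  then show ?thesis using fU_cancel by algebra
qed

text \<open>The common factor X is pulled out and written as X U (1 - X), exposing the X U that
  stands before the odd part.\<close>

lemma hadamard_XU_XU:
  "(fps_X * fU * H) \<odot> (fps_X * fU * H') = fps_X * fU * ((1 - fps_X) * ((fU * H) \<odot> (fU * H')))"
  using fU_cancel hadamard_X_X[of "fU * H" "fU * H'"] unfolding mult.assoc by algebra

lemma hadamard_decomp:
  "(G + fps_X * fU * H) \<odot> (G' + fps_X * fU * H')
   = prod_even G H G' H' + fps_X * fU * prod_odd G H G' H'"
  unfolding prod_even_def prod_odd_def hadamard_simps hadamard_XU_XU hadamard_cross[of G H']
    hadamard_commute[of "fps_X * fU * H"] hadamard_commute[of H G'] hadamard_cross[of G' H]
  by (simp add: algebra_simps)

lemma prod_gcone: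
  assumes S: "S = UNIV \<or> S = {0..}"
    and G: "G \<in> gcone 1 S 0 (d + 1)" and H: "H \<in> gcone 1 S 0 d"
    and G': "G' \<in> gcone 1 S 0 (d' + 1)" and H': "H' \<in> gcone 1 S 0 d'"
  shows "prod_even G H G' H' \<in> gcone 1 S 0 (d + d' + 1)" "prod_odd G H G' H' \<in> gcone 1 S 0 (d + d')"
proof -
  have 1: "G \<odot> G' \<in> gcone 1 S 0 (d + d' + 1)"
    using gcone_hadamard[OF G G' _ _ S] by simp
  \<comment> \<open>For e = 0 the second factor must have K \<ge> 1, which X U provides; the next
    term swaps its factors for the same reason.\<close>
  have 2: "fU * (((1 - fps_X) * G) \<odot> (fps_X * fU * H')) \<in> gcone 1 S 0 (d + d' + 1)"
    using gcone_0_imp_1[OF gcone_hadamard[OF gcone_1_imp_0[OF G S] gcone_XU[OF H' S] _ _ S] S] by simp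
  have 3: "fU * ((fps_X * fU * H) \<odot> ((1 - fps_X) * G')) \<in> gcone 1 S 0 (d + d' + 1)"
    using gcone_0_imp_1[OF gcone_hadamard[OF gcone_1_imp_0[OF G' S] gcone_XU[OF H S] _ _ S] S]
    by (simp add: hadamard_commute[of "fps_X * fU * H"] add.commute)
  show "prod_even G H G' H' \<in> gcone 1 S 0 (d + d' + 1)"
    unfolding prod_even_def by (intro lcone_add 1 2 3)
  have 4: "G \<odot> H' \<in> gcone 1 S 0 (d + d')" using gcone_hadamard[OF G H' _ _ S] by simp
  have 5: "H \<odot> G' \<in> gcone 1 S 0 (d + d')" using gcone_hadamard[OF H G' _ _ S] by simp
  \<comment> \<open>The last odd term is reached indirectly: multiplied by X U it is a Hadamard
    product of two series with e = 0, and X U can be cancelled.\<close>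
  have "(fps_X * fU * H) \<odot> (fps_X * fU * H') \<in> gcone 0 S 1 (d + d' + 1)"
    using gcone_hadamard[OF gcone_XU[OF H S] gcone_XU[OF H' S] _ _ S] by simp
  then have 6: "(1 - fps_X) * ((fU * H) \<odot> (fU * H')) \<in> gcone 1 S 0 (d + d')"
    unfolding hadamard_XU_XU by (rule gcone_XU_cancel)
  show "prod_odd G H G' H' \<in> gcone 1 S 0 (d + d')"
    unfolding prod_odd_def by (intro lcone_add 4 5 6)
qed

section \<open>Products of series with nonnegative numerators\<close>

definition fQ :: "nat \<Rightarrow> nat \<Rightarrow> real fps" where "fQ i r = fps_X ^ i * fU ^ r"

text \<open>With a half-open range, \<open>hi = 0\<close> leaves only the zero series in the cone,
  matching b = 0 when d = 0.\<close>

definition fQ_set :: "nat \<Rightarrow> nat \<Rightarrow> nat \<Rightarrow> real fps set" where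
  "fQ_set lo hi r = {fQ i r | i. lo \<le> i \<and> i < hi}"

abbreviation bcone :: "nat \<Rightarrow> nat \<Rightarrow> nat \<Rightarrow> real fps set" where
  "bcone lo hi r \<equiv> lcone {0..} (fQ_set lo hi r)"

text \<open>Taking c = t - k kills the second term and c = -k the first, so t can be raised with or
  without a shift of k.\<close>

lemma euler_op_fQ:
  "euler_op (fQ k t) + fps_const c * fQ k t
   = fps_const (of_nat k + c) * fQ k (t + 1) + fps_const (of_nat t - of_nat k - c) * fQ (k + 1) (t + 1)"
proof -
  have X: "euler_op (fps_X ^ k) = of_nat k * fps_X ^ k"
    unfolding euler_op_power euler_op_X by (cases k) (simp_all add: algebra_simps)
  have U: "euler_op (fU ^ t) = of_nat t * fps_X * fU ^ (t + 1)"
    unfolding euler_op_power euler_op_fU by (cases t) (simp_all add: algebra_simps power2_eq_square)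
  have Q: "fQ k t = fQ k (t + 1) - fQ (k + 1) (t + 1)"
  proof -
    have "fQ k t = fQ k t * ((1 - fps_X) * fU)" unfolding fU_cancel by simp
    then show ?thesis by (simp add: fQ_def algebra_simps)
  qed
  have "euler_op (fQ k t) = of_nat k * fQ k t + of_nat t * fQ (k + 1) (t + 1)"
    unfolding fQ_def euler_op_simps X U by (simp add: algebra_simps)
  also have "\<dots> = fps_const (of_nat k) * (fQ k (t + 1) - fQ (k + 1) (t + 1)) + fps_const (of_nat t) * fQ (k + 1) (t + 1)"
    unfolding Q[symmetric] by (simp add: fps_of_nat)
  finally have E: "euler_op (fQ k t) = \<dots>" .
  show ?thesis unfolding E by (subst Q) (simp add: algebra_simps flip: fps_const_add fps_const_sub)
qed

lemma bcone_fQ: "c = 0 \<or> 0 \<le> c \<and> lo \<le> i \<and> i < hi \<Longrightarrow> fps_const c * fQ i r \<in> bcone lo hi r"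
  using lcone_base[of c "{0..}" "fQ i r" "fQ_set lo hi r"] lcone.zero by (auto simp: fQ_set_def)

lemma bcone_euler_op:
  assumes f: "f \<in> bcone lo hi t"
    and c: "\<And>k. lo \<le> k \<Longrightarrow> k < hi \<Longrightarrow> (of_nat k + c = 0 \<or> 0 \<le> of_nat k + c \<and> lo' \<le> k \<and> k < hi') \<and>
      (of_nat t - of_nat k - c = 0 \<or> 0 \<le> of_nat t - of_nat k - c \<and> lo' \<le> k + 1 \<and> k + 1 < hi')"
  shows "euler_op f + fps_const c * f \<in> bcone lo' hi' (t + 1)"
proof (rule lcone_map[OF f, where L = "\<lambda>f. euler_op f + fps_const c * f"])
  fix u assume "u \<in> fQ_set lo hi t"
  then obtain k where k: "u = fQ k t" "lo \<le> k" "k < hi" by (auto simp: fQ_set_def)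
  show "euler_op u + fps_const c * u \<in> bcone lo' hi' (t + 1)"
    unfolding k euler_op_fQ using c[OF k(2,3)] by (intro lcone_add bcone_fQ) auto
qed (auto simp: fps_eq_iff algebra_simps)

text \<open>The range of indices \<open>k\<close> is what keeps both coefficients in the formula for
  \<open>X d/dX + c\<close> nonnegative along the induction.\<close>

lemma hadamard_fQ_bcone:
  assumes "i \<le> r" "j \<le> s"
  shows "fQ i (r + 1) \<odot> fQ j (s + 1) \<in> bcone i (i + s + 1) (r + s + 1)"
  using assms(1)
proof (induction r arbitrary: i)
  case 0
  have "fQ 0 1 = fU" by (simp add: fQ_def)
  then have "fQ 0 1 \<odot> fQ j (s + 1) = fQ j (s + 1)"
    by (simp add: hadamard_commute[of fU])
  then show ?case using 0 bcone_fQ[of 1 0 j "s + 1" "s + 1"] assms(2) by simp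
next
  case (Suc r)
  have had: "fps_const (1 / real (r + 1)) * (euler_op (F \<odot> G) + fps_const c * (F \<odot> G)) = F' \<odot> G"
    if "euler_op F + fps_const c * F = fps_const (real (r + 1)) * F'" for F F' G c
  proof (rule fps_ext)
    fix n
    have "fps_nth (euler_op F + fps_const c * F) n = fps_nth (fps_const (real (r + 1)) * F') n"
      using that by simp
    then have "(real n + c) * fps_nth F n = real (r + 1) * fps_nth F' n" by (simp add: algebra_simps)
    then have "fps_nth F' n = (1 / real (r + 1)) * ((real n + c) * fps_nth F n)" by simp
    then show "fps_nth (fps_const (1 / real (r + 1)) * (euler_op (F \<odot> G) + fps_const c * (F \<odot> G))) n = fps_nth (F' \<odot> G) n"
      by (simp add: algebra_simps)
  qed
  show ?case
  proof (cases "i \<le> r")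
    case True
    \<comment> \<open>This \<open>c\<close> keeps \<open>i\<close> fixed. On index k of the product
      the second coefficient is s + i - k, zero at the top index i + s.\<close>
    define c where "c = real (r + 1) - real i"
    have "euler_op (fQ i (r + 1)) + fps_const c * fQ i (r + 1) = fps_const (real (r + 1)) * fQ i (r + 2)"
      unfolding euler_op_fQ by (simp add: c_def)
    note eq = had[OF this, of "fQ j (s + 1)"]
    have "euler_op (fQ i (r + 1) \<odot> fQ j (s + 1)) + fps_const c * (fQ i (r + 1) \<odot> fQ j (s + 1))
      \<in> bcone i (i + s + 1) (r + s + 1 + 1)"
      using Suc.IH[OF True] by (rule bcone_euler_op) (use True in \<open>auto simp: c_def\<close>)
    then have "fQ i (r + 2) \<odot> fQ j (s + 1) \<in> bcone i (i + s + 1) (r + s + 1 + 1)"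
      unfolding eq[symmetric] by (rule lcone_scale) auto
    then show ?thesis by simp
  next
    case False
    then have i: "i = Suc r" using Suc.prems by simp
    \<comment> \<open>This \<open>c\<close> shifts the index from r to r + 1. On index k of the
      product the first coefficient is k - r, zero at the bottom index r.\<close>
    define c where "c = - real r"
    have "euler_op (fQ r (r + 1)) + fps_const c * fQ r (r + 1) = fps_const (real (r + 1)) * fQ i (r + 2)"
      unfolding euler_op_fQ by (simp add: c_def i)
    note eq = had[OF this, of "fQ j (s + 1)"]
    have "euler_op (fQ r (r + 1) \<odot> fQ j (s + 1)) + fps_const c * (fQ r (r + 1) \<odot> fQ j (s + 1))
      \<in> bcone i (i + s + 1) (r + s + 1 + 1)"
      using Suc.IH[OF order.refl] by (rule bcone_euler_op) (auto simp: c_def i)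
    then have "fQ i (r + 2) \<odot> fQ j (s + 1) \<in> bcone i (i + s + 1) (r + s + 1 + 1)"
      unfolding eq[symmetric] by (rule lcone_scale) auto
    then show ?thesis by simp
  qed
qed

text \<open>Records only the sign of the numerator; its degree and symmetry come from the cones over
  all reals.\<close>

definition nonneg_num :: "nat \<Rightarrow> real fps \<Rightarrow> bool" where
  "nonneg_num r f \<longleftrightarrow> (\<forall>n. 0 \<le> fps_nth ((1 - fps_X) ^ r * f) n)"

lemma nonneg_num_0: "nonneg_num r 0"
  by (simp add: nonneg_num_def)

lemma nonneg_num_add: "nonneg_num r f \<Longrightarrow> nonneg_num r g \<Longrightarrow> nonneg_num r (f + g)"
  by (simp add: nonneg_num_def distrib_left)

lemma nonneg_num_X: "nonneg_num r f \<Longrightarrow> nonneg_num r (fps_X * f)"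
  by (simp add: nonneg_num_def mult.left_commute[of _ fps_X])

lemma nonneg_num_scale: "nonneg_num r f \<Longrightarrow> 0 \<le> c \<Longrightarrow> nonneg_num r (fps_const c * f)"
  by (simp add: nonneg_num_def mult.left_commute[of _ "fps_const c"])

lemma nonneg_num_U: "nonneg_num r f \<Longrightarrow> nonneg_num (r + 1) (fU * f)"
proof -
  have "(1 - fps_X) ^ (r + 1) * (fU * f) = (1 - fps_X) ^ r * f * ((1 - fps_X) * fU)"
    by (simp add: algebra_simps)
  then have "(1 - fps_X) ^ (r + 1) * (fU * f) = (1 - fps_X) ^ r * f"
    unfolding fU_cancel by simp
  then show "nonneg_num r f \<Longrightarrow> nonneg_num (r + 1) (fU * f)"
    unfolding nonneg_num_def by metis
qed

lemma nonneg_num_1_minus_X: "nonneg_num (r + 1) f \<Longrightarrow> nonneg_num r ((1 - fps_X) * f)"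
  by (simp add: nonneg_num_def algebra_simps)

lemma fU_power_cancel: "(1 - fps_X) ^ r * fU ^ r = 1"
  by (simp add: fU_cancel flip: power_mult_distrib)

lemma nonneg_num_bcone:
  assumes "f \<in> bcone lo hi r" shows "nonneg_num r f"
  using assms
proof (induction rule: lcone.induct)
  case (step c t f)
  then obtain i where t: "t = fQ i r" by (auto simp: fQ_set_def)
  have "(1 - fps_X) ^ r * t = fps_X ^ i"
    using fU_power_cancel[of r] unfolding t fQ_def by (simp add: mult.left_commute)
  then have "nonneg_num r t" by (simp add: nonneg_num_def fps_X_power_nth)
  then show ?case using step by (intro nonneg_num_add nonneg_num_scale) auto
qed (rule nonneg_num_0)

lemma nonneg_num_hadamard:
  assumes f: "f \<in> bcone lo hi r" and g: "g \<in> bcone lo' hi' s"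
    and Q: "\<And>i j. lo \<le> i \<Longrightarrow> i < hi \<Longrightarrow> lo' \<le> j \<Longrightarrow> j < hi' \<Longrightarrow> nonneg_num t (fQ i r \<odot> fQ j s)"
  shows "nonneg_num t (f \<odot> g)"
  using f
proof (induction rule: lcone.induct)
  case (step c u f)
  then obtain i where u: "u = fQ i r" "lo \<le> i" "i < hi" by (auto simp: fQ_set_def)
  have "nonneg_num t (u \<odot> g)"
    using g
  proof (induction rule: lcone.induct)
    case (step c v g)
    then obtain j where v: "v = fQ j s" "lo' \<le> j" "j < hi'" by (auto simp: fQ_set_def)
    show ?case unfolding hadamard_simps
      using step u v Q by (intro nonneg_num_add nonneg_num_scale) auto
  qed (simp add: hadamard_simps nonneg_num_0)
  then show ?case unfolding hadamard_simps
    using step by (intro nonneg_num_add nonneg_num_scale) auto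
qed (simp add: hadamard_simps nonneg_num_0)

lemma nonneg_num_hadamard_fQ:
  assumes "i < r" "j < s" "t + 1 = r + s" shows "nonneg_num t (fQ i r \<odot> fQ j s)"
proof -
  have "t = (r - 1) + (s - 1) + 1" using assms by simp
  then show ?thesis
    using nonneg_num_bcone[OF hadamard_fQ_bcone[of i "r - 1" j "s - 1"]] assms by simp
qed

text \<open>Here \<open>i = d\<close> is allowed at the cost of \<open>j \<ge> 1\<close>: a factor \<open>X\<close> can then be split off from both series.\<close>

lemma nonneg_num_hadamard_fQ_diag:
  assumes "i \<le> d" "1 \<le> j" "j < s" "t + 1 = d + s" shows "nonneg_num t (fQ i d \<odot> fQ j s)"
proof -
  consider "i < d" | "i = d" "d = 0" | "i = d" "0 < d" using assms by linarith
  then show ?thesis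
  proof cases
    case 1 then show ?thesis using nonneg_num_hadamard_fQ assms by simp
  next
    case 2
    have "fQ 0 0 = 1" "fps_nth (fQ j s) 0 = 0" using assms by (auto simp: fQ_def)
    then show ?thesis using 2 by (simp add: hadamard_one nonneg_num_0)
  next
    case 3
    have "fQ (Suc k) r = fps_X * fQ k r" for k r by (simp add: fQ_def)
    from this[of "i - 1" d] this[of "j - 1" s]
    have "fQ i d \<odot> fQ j s = fps_X * (fQ (i - 1) d \<odot> fQ (j - 1) s)"
      using assms 3 by (simp add: hadamard_X_X)
    then show ?thesis using nonneg_num_X nonneg_num_hadamard_fQ[of "i - 1" d "j - 1" s t] assms 3 by simp
  qed
qed

lemma prod_nonneg_num:
  assumes G: "G \<in> bcone 0 (d + 1) (d + 1)" and H: "H \<in> bcone 0 d d"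
    and G': "G' \<in> bcone 0 (d' + 1) (d' + 1)" and H': "H' \<in> bcone 0 d' d'"
  shows "nonneg_num (d + d' + 1) (prod_even G H G' H')" "nonneg_num (d + d') (prod_odd G H G' H')"
proof -
  have "fU * fQ i r = fQ i (r + 1)" for i r by (simp add: fQ_def)
  then have UH: "fU * h \<in> bcone 0 r (r + 1)" if "h \<in> bcone 0 r r" for h r
    using that by (rule_tac lcone_map_mult) (auto simp: fQ_set_def)
  have "fps_X * fU * fQ i r = fQ (i + 1) (r + 1)" for i r by (simp add: fQ_def algebra_simps)
  then have XUH: "fps_X * fU * h \<in> bcone 1 (r + 1) (r + 1)" if "h \<in> bcone 0 r r" for h r
    using that by (rule_tac lcone_map_mult) (auto simp: fQ_set_def)
  \<comment> \<open>The exponent of X may now equal that of U, the boundary case treated by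
    \<open>nonneg_num_hadamard_fQ_diag\<close>.\<close>
  have "(1 - fps_X) * fQ i (r + 1) = fQ i r * ((1 - fps_X) * fU)" for i r
    by (simp add: fQ_def algebra_simps)
  then have DG: "(1 - fps_X) * g \<in> bcone 0 (r + 1) r" if "g \<in> bcone 0 (r + 1) (r + 1)" for g r
    using that by (rule_tac lcone_map_mult) (auto simp: fQ_set_def fU_cancel)
  show "nonneg_num (d + d' + 1) (prod_even G H G' H')"
    unfolding prod_even_def
  proof (intro nonneg_num_add nonneg_num_U)
    show "nonneg_num (d + d' + 1) (G \<odot> G')"
      using G G' by (rule nonneg_num_hadamard) (rule nonneg_num_hadamard_fQ, auto)
    show "nonneg_num (d + d') (((1 - fps_X) * G) \<odot> (fps_X * fU * H'))"
      using DG[OF G] XUH[OF H'] by (rule nonneg_num_hadamard) (rule nonneg_num_hadamard_fQ_diag, auto)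
    show "nonneg_num (d + d') ((fps_X * fU * H) \<odot> ((1 - fps_X) * G'))"
      unfolding hadamard_commute[of "fps_X * fU * H"] using DG[OF G'] XUH[OF H]
      by (rule nonneg_num_hadamard) (rule nonneg_num_hadamard_fQ_diag, auto)
  qed
  show "nonneg_num (d + d') (prod_odd G H G' H')"
    unfolding prod_odd_def
  proof (intro nonneg_num_add nonneg_num_1_minus_X)
    show "nonneg_num (d + d') (G \<odot> H')"
      using G H' by (rule nonneg_num_hadamard) (rule nonneg_num_hadamard_fQ, auto)
    show "nonneg_num (d + d') (H \<odot> G')"
      using H G' by (rule nonneg_num_hadamard) (rule nonneg_num_hadamard_fQ, auto)
    show "nonneg_num (d + d' + 1) ((fU * H) \<odot> (fU * H'))"
      using UH[OF H] UH[OF H'] by (rule nonneg_num_hadamard) (rule nonneg_num_hadamard_fQ, auto)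
  qed
qed

section \<open>Symmetric decompositions\<close>

text \<open>Indexed by the denominator exponent: r = d + 1 gives the form of a and r = d that of b,
  with an empty sum for b when d = 0.\<close>

definition gamma_poly :: "(nat \<Rightarrow> real) \<Rightarrow> nat \<Rightarrow> real poly" where
  "gamma_poly c r = (\<Sum>i | 2 * i + 1 \<le> r. smult (c i) (monom 1 i * [:1, 1:] ^ (r - 1 - 2 * i)))"

lemma finite_gamma_index: "finite {i :: nat. 2 * i + 1 \<le> r}"
  by (rule finite_subset[of _ "{..r}"]) auto

lemma fps_of_gamma_term:
  "fps_of_poly (smult c (monom 1 i * [:1, 1:] ^ n)) * fU ^ (2 * i + n + 1) = fps_const c * fT 1 i n"
proof -
  have "fps_of_poly [:1, 1 :: real:] = 1 + fps_X" by (simp add: fps_of_poly_pCons)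
  then show ?thesis
    by (simp add: fps_of_poly_smult fps_of_poly_mult fps_of_poly_power fps_of_poly_monom fT_def fY_def fR_def
      power_mult_distrib power_add flip: power_mult)
qed

lemma fps_of_gamma_poly:
  "fps_of_poly (gamma_poly c r) * fU ^ r = (\<Sum>i | 2 * i + 1 \<le> r. fps_const (c i) * fT 1 i (r - 1 - 2 * i))"
  unfolding gamma_poly_def fps_of_poly_sum sum_distrib_right
proof (rule sum.cong[OF refl])
  fix i assume "i \<in> {i. 2 * i + 1 \<le> r}"
  then have "2 * i + (r - 1 - 2 * i) + 1 = r" by auto
  then show "fps_of_poly (smult (c i) (monom 1 i * [:1, 1:] ^ (r - 1 - 2 * i))) * fU ^ r
      = fps_const (c i) * fT 1 i (r - 1 - 2 * i)"
    using fps_of_gamma_term[of "c i" i "r - 1 - 2 * i"] by simp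
qed

lemma gamma_poly_in_gcone:
  assumes "\<And>i. c i \<in> S" shows "fps_of_poly (gamma_poly c r) * fU ^ r \<in> gcone 1 S 0 r"
  unfolding fps_of_gamma_poly
  by (rule lcone_sum, rule lcone_base[OF assms], rule fT_setI) auto

lemma gcone_imp_gamma_poly:
  assumes "f \<in> gcone 1 S 0 r" and S: "S = UNIV \<or> S = {0..}"
  shows "\<exists>c. (\<forall>i. c i \<in> S) \<and> f = fps_of_poly (gamma_poly c r) * fU ^ r"
  using assms(1)
proof (induction rule: lcone.induct)
  case zero
  show ?case using S by (intro exI[of _ "\<lambda>_. 0"]) (auto simp: gamma_poly_def)
next
  case (step x t f)
  obtain c where c: "\<forall>i. c i \<in> S" "f = fps_of_poly (gamma_poly c r) * fU ^ r" using step.IH by blast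
  from \<open>t \<in> fT_set 1 0 r\<close> obtain k n where t: "t = fT 1 k n" "2 * k + n + 1 = r" by (rule fT_setE)
  then have n: "n = r - 1 - 2 * k" by auto
  define c' where "c' i = (if i = k then x else 0) + c i" for i
  have "fps_of_poly (gamma_poly c' r) * fU ^ r
      = (\<Sum>i | 2 * i + 1 \<le> r. if i = k then fps_const x * fT 1 i (r - 1 - 2 * i) else 0) + f"
    unfolding c(2) fps_of_gamma_poly sum.distrib[symmetric]
    by (rule sum.cong) (auto simp: c'_def distrib_right simp flip: fps_const_add)
  also have "\<dots> = fps_const x * t + f"
    using finite_gamma_index[of r] t unfolding n[symmetric] by (subst sum.delta) auto
  finally have "fps_const x * t + f = fps_of_poly (gamma_poly c' r) * fU ^ r" ..
  moreover have "\<forall>i. c' i \<in> S" using c(1) S step.hyps by (auto simp: c'_def)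
  ultimately show ?case by blast
qed

lemma gamma_poly_symmetric:
  "degree (gamma_poly c (s + 1)) \<le> s" "I_poly s (gamma_poly c (s + 1)) = gamma_poly c (s + 1)"
proof -
  show deg: "degree (gamma_poly c (s + 1)) \<le> s"
    unfolding gamma_poly_def
  proof (rule degree_sum_le[OF finite_gamma_index])
    fix i assume i: "i \<in> {i. 2 * i + 1 \<le> s + 1}"
    have "degree ([:1, 1 :: real:] ^ (s + 1 - 1 - 2 * i)) \<le> s - 2 * i"
      by (rule order.trans[OF degree_power_le]) simp
    then have "degree (monom 1 i * [:1, 1 :: real:] ^ (s + 1 - 1 - 2 * i)) \<le> s"
      using i degree_mult_le[of "monom 1 i" "[:1, 1 :: real:] ^ (s + 1 - 1 - 2 * i)"]
        degree_monom_le[of "1 :: real" i] by simp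
    then show "degree (smult (c i) (monom 1 i * [:1, 1:] ^ (s + 1 - 1 - 2 * i))) \<le> s"
      using degree_smult_le order.trans by blast
  qed
  show "I_poly s (gamma_poly c (s + 1)) = gamma_poly c (s + 1)"
  proof (rule poly_eqI_nz)
    fix x :: real assume x: "x \<noteq> 0" "x \<noteq> 1"
    have "x ^ s * (c i * ((1 / x) ^ i * (1 + 1 / x) ^ (s - 2 * i))) = c i * (x ^ i * (1 + x) ^ (s - 2 * i))"
      if "2 * i \<le> s" for i
    proof -
      have "x ^ s = x ^ i * x ^ i * x ^ (s - 2 * i)" using that by (simp flip: power_add mult_2)
      moreover have "x ^ (s - 2 * i) * (1 + 1 / x) ^ (s - 2 * i) = (1 + x) ^ (s - 2 * i)"
        using x by (simp add: distrib_left add.commute flip: power_mult_distrib)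
      moreover have "x ^ i * (1 / x) ^ i = 1" using x by (simp flip: power_mult_distrib)
      moreover have "x ^ i * x ^ i * x ^ (s - 2 * i) * (c i * ((1 / x) ^ i * (1 + 1 / x) ^ (s - 2 * i)))
          = c i * (x ^ i * (x ^ i * (1 / x) ^ i) * (x ^ (s - 2 * i) * (1 + 1 / x) ^ (s - 2 * i)))"
        by (simp only: mult_ac)
      ultimately show ?thesis by (simp only: mult_1_right)
    qed
    then have "(\<Sum>i | 2 * i \<le> s. x ^ s * (c i * ((1 / x) ^ i * (1 + 1 / x) ^ (s - 2 * i))))
        = (\<Sum>i | 2 * i \<le> s. c i * (x ^ i * (1 + x) ^ (s - 2 * i)))"
      by (intro sum.cong) auto
    then show "poly (I_poly s (gamma_poly c (s + 1))) x = poly (gamma_poly c (s + 1)) x"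
      unfolding poly_I_poly[OF deg x(1)]
      by (simp add: gamma_poly_def poly_sum sum_distrib_left poly_monom)
  qed
qed

lemma is_symm_decomp_gamma_poly:
  "is_symm_decomp d (gamma_poly c (d + 1) + [:0, 1:] * gamma_poly c' d) (gamma_poly c (d + 1), gamma_poly c' d)"
  using gamma_poly_symmetric[where c = c and s = d] gamma_poly_symmetric[where c = c' and s = "d - 1"]
  by (cases d) (auto simp: is_symm_decomp_def gamma_poly_def)

lemma coeff_I_poly:
  assumes "degree a \<le> s" "i \<le> s" shows "coeff (I_poly s a) i = coeff a (s - i)"
  using assms by (auto simp: I_poly_def coeff_monom_mult coeff_reflect_poly intro: coeff_eq_0 arg_cong[of _ _ "coeff a"])

text \<open>Subtracting \<open>coeff a 0\<close> times (1+x)^s clears the constant and, by symmetry,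
  the top coefficient. What remains is x times a palindromic polynomial for s - 2, and Y restores
  both x and (1-x)^2.\<close>

lemma palindromic_in_gcone:
  assumes "degree a \<le> s" "\<And>i. i \<le> s \<Longrightarrow> coeff a i = coeff a (s - i)"
  shows "fps_of_poly a * fU ^ (s + 1) \<in> gcone 1 UNIV 0 (s + 1)"
  using assms
proof (induction s arbitrary: a rule: less_induct)
  case (less s)
  define x where "x = coeff a 0"
  define f where "f = a - smult x ([:1, 1:] ^ s)"
  have co: "coeff ([:1, 1 :: real:] ^ s) i = real (s choose i)" for i
    by (cases "i \<le> s") (auto simp: coeff_linear_poly_power coeff_eq_0 degree_linear_power)
  have degf: "degree f \<le> s"
    unfolding f_def using less.prems(1) degree_power_le[of "[:1, 1 :: real:]" s]
    by (intro degree_diff_le order.trans[OF degree_smult_le]) auto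
  have symf: "coeff f i = coeff f (s - i)" if "i \<le> s" for i
    using less.prems(2)[OF that] binomial_symmetric[OF that] by (simp add: f_def co)
  have f0: "coeff f 0 = 0" by (simp add: f_def co x_def)
  have top: "coeff f i = 0" if "i \<ge> s" for i
    using f0 symf[of s] degf that by (cases "i = s") (auto intro: coeff_eq_0)
  obtain g where g: "f = pCons 0 g" using f0 by (cases f) auto
  have "fps_of_poly f * fU ^ (s + 1) \<in> gcone 1 UNIV 0 (s + 1)"
  proof (cases "s \<le> 1")
    case True
    have "coeff f i = 0" for i using f0 top[of i] True by (cases "i = 0") auto
    then have "f = 0" by (simp add: poly_eq_iff)
    then show ?thesis by (simp add: lcone.zero)
  next
    case False
    have cg: "coeff g i = coeff f (i + 1)" for i by (simp add: g)
    have "fps_of_poly g * fU ^ (s - 2 + 1) \<in> gcone 1 UNIV 0 (s - 2 + 1)"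
    proof (rule less.IH)
      show "degree g \<le> s - 2" by (rule degree_le) (use False in \<open>auto simp: cg intro!: top\<close>)
      show "coeff g i = coeff g (s - 2 - i)" if "i \<le> s - 2" for i
      proof -
        have "s - (i + 1) = s - 2 - i + 1" using that False by auto
        then show ?thesis using symf[of "i + 1"] that False unfolding cg by simp
      qed
    qed (use False in auto)
    then have "fY * (fps_of_poly g * fU ^ (s - 2 + 1)) \<in> gcone 1 UNIV (0 + 1) (s - 2 + 1 + 2)"
      by (rule gcone_fY) auto
    moreover have "fY * (fps_of_poly g * fU ^ (s - 2 + 1)) = fps_of_poly f * fU ^ (s + 1)"
    proof -
      have "s + 1 = 2 + (s - 2 + 1)" using False by simp
      then have "fU ^ (s + 1) = fU\<^sup>2 * fU ^ (s - 2 + 1)" by (metis power_add)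
      then show ?thesis unfolding g fY_def by (auto simp: fps_of_poly_pCons mult_ac)
    qed
    moreover have "s - 2 + 1 + 2 = s + 1" using False by simp
    ultimately have "fps_of_poly f * fU ^ (s + 1) \<in> gcone 1 UNIV (0 + 1) (s + 1)" by argo
    then show ?thesis by (rule gcone_mono) auto
  qed
  moreover have "fps_of_poly (smult x ([:1, 1:] ^ s)) * fU ^ (s + 1) \<in> gcone 1 UNIV 0 (s + 1)"
    using fps_of_gamma_term[of x 0 s] lcone_base[of x UNIV "fT 1 0 s"] fT_setI[of 0 0 s 1 "s + 1"]
    by (simp flip: pCons_one)
  ultimately have "fps_of_poly f * fU ^ (s + 1) + fps_of_poly (smult x ([:1, 1:] ^ s)) * fU ^ (s + 1) \<in> gcone 1 UNIV 0 (s + 1)"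
    by (rule lcone_add)
  moreover have "fps_of_poly f * fU ^ (s + 1) + fps_of_poly (smult x ([:1, 1:] ^ s)) * fU ^ (s + 1) = fps_of_poly a * fU ^ (s + 1)"
    unfolding distrib_right[symmetric] fps_of_poly_add[symmetric] f_def by simp
  ultimately show ?case by simp
qed

section \<open>From generating functions back to symmetric decompositions\<close>

definition eval_fps_nat :: "real poly \<Rightarrow> real fps" where
  "eval_fps_nat p = Abs_fps (\<lambda>j. poly p (of_nat j))"

lemma eval_fps_nat_mult: "eval_fps_nat (p * q) = eval_fps_nat p \<odot> eval_fps_nat q"
  by (simp add: eval_fps_nat_def fps_eq_iff)

lemma eval_fps_nat_W: "eval_fps_nat p = fps_of_poly (W_poly p) * fU ^ (degree p + 1)"
proof -
  have "eval_fps_nat p * (1 - fps_X) ^ (degree p + 1) = fps_of_poly (W_poly p)"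
    using W_poly(2)[of p] unfolding fps_eq_divide_iff eval_fps_nat_def .
  then have "fps_of_poly (W_poly p) * fU ^ (degree p + 1)
      = eval_fps_nat p * ((1 - fps_X) ^ (degree p + 1) * fU ^ (degree p + 1))"
    by (metis mult.assoc)
  then show ?thesis unfolding fU_power_cancel by simp
qed

lemma fps_of_decomp:
  "fps_of_poly (a + [:0, 1:] * b) * fU ^ (d + 1)
   = fps_of_poly a * fU ^ (d + 1) + fps_X * fU * (fps_of_poly b * fU ^ d)"
  by (simp add: fps_of_poly_add fps_of_poly_pCons algebra_simps)

lemma eval_fps_nat_decomp:
  assumes "symm_decomp (degree p) (W_poly p) = (a, b)"
  shows "eval_fps_nat p = fps_of_poly a * fU ^ (degree p + 1) + fps_X * fU * (fps_of_poly b * fU ^ degree p)"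
    "fps_of_poly a * fU ^ (degree p + 1) \<in> gcone 1 UNIV 0 (degree p + 1)"
    "fps_of_poly b * fU ^ degree p \<in> gcone 1 UNIV 0 (degree p)"
    "degree a < degree p + 1" "b = 0 \<or> degree b < degree p"
proof -
  let ?d = "degree p"
  have dec: "is_symm_decomp ?d (W_poly p) (a, b)"
    using is_symm_decomp_symm_decomp[OF W_poly(1)[of p]] assms by simp
  then have W: "W_poly p = a + [:0, 1:] * b" and a: "degree a \<le> ?d" "I_poly ?d a = a"
    and b: "if ?d = 0 then b = 0 else degree b \<le> ?d - 1 \<and> I_poly (?d - 1) b = b"
    by (auto simp: is_symm_decomp_def)
  show "eval_fps_nat p = fps_of_poly a * fU ^ (?d + 1) + fps_X * fU * (fps_of_poly b * fU ^ ?d)"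
    unfolding eval_fps_nat_W W fps_of_decomp ..
  show "fps_of_poly a * fU ^ (?d + 1) \<in> gcone 1 UNIV 0 (?d + 1)"
    using a coeff_I_poly[OF a(1)] by (intro palindromic_in_gcone) metis+
  show "fps_of_poly b * fU ^ ?d \<in> gcone 1 UNIV 0 ?d"
  proof (cases "?d = 0")
    case True then show ?thesis using b by (simp add: lcone.zero)
  next
    case False
    then have "fps_of_poly b * fU ^ (?d - 1 + 1) \<in> gcone 1 UNIV 0 (?d - 1 + 1)"
      using b coeff_I_poly[of b "?d - 1"] by (intro palindromic_in_gcone) metis+
    then show ?thesis using False by simp
  qed
  show "degree a < ?d + 1" using a by simp
  show "b = 0 \<or> degree b < ?d" using b by (auto split: if_splits)
qed

text \<open>Cancelling the power of U gives a decomposition of \<open>W_poly p\<close>, and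
  uniqueness identifies it.\<close>

lemma symm_decomp_eqI:
  assumes "eval_fps_nat p = fps_of_poly (gamma_poly c (degree p + 1)) * fU ^ (degree p + 1)
    + fps_X * fU * (fps_of_poly (gamma_poly c' (degree p)) * fU ^ degree p)"
  shows "symm_decomp (degree p) (W_poly p) = (gamma_poly c (degree p + 1), gamma_poly c' (degree p))"
proof -
  let ?w = "gamma_poly c (degree p + 1) + [:0, 1:] * gamma_poly c' (degree p)"
  have "fps_of_poly (W_poly p) * fU ^ (degree p + 1) = fps_of_poly ?w * fU ^ (degree p + 1)"
    using assms unfolding fps_of_decomp eval_fps_nat_W .
  moreover have "fU \<noteq> 0" using fU_cancel by auto
  ultimately have "W_poly p = ?w" by (simp add: fps_of_poly_eq_iff)
  then have "is_symm_decomp (degree p) (W_poly p) (gamma_poly c (degree p + 1), gamma_poly c' (degree p))"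
    using is_symm_decomp_gamma_poly by simp
  then show ?thesis
    using symm_decomp_ex1[OF W_poly(1)[of p]] is_symm_decomp_symm_decomp[OF W_poly(1)[of p]] by blast
qed

text \<open>Taking \<open>S = UNIV\<close> yields palindromicity for the nonnegative case, and
  \<open>S = {0..}\<close> yields \<gamma>-positivity itself.\<close>

lemma symm_decomp_mult:
  assumes S: "S = UNIV \<or> S = {0..}" and deg: "degree (p * q) = degree p + degree q"
    and p: "eval_fps_nat p = G + fps_X * fU * H" "G \<in> gcone 1 S 0 (degree p + 1)" "H \<in> gcone 1 S 0 (degree p)"
    and q: "eval_fps_nat q = G' + fps_X * fU * H'" "G' \<in> gcone 1 S 0 (degree q + 1)" "H' \<in> gcone 1 S 0 (degree q)"
  obtains c c' where "\<forall>i. c i \<in> S" "\<forall>i. c' i \<in> S"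
    "symm_decomp (degree (p * q)) (W_poly (p * q)) = (gamma_poly c (degree (p * q) + 1), gamma_poly c' (degree (p * q)))"
    "prod_even G H G' H' = fps_of_poly (gamma_poly c (degree (p * q) + 1)) * fU ^ (degree (p * q) + 1)"
    "prod_odd G H G' H' = fps_of_poly (gamma_poly c' (degree (p * q))) * fU ^ degree (p * q)"
proof -
  note P = prod_gcone[OF S p(2,3) q(2,3), folded deg]
  obtain c where c: "\<forall>i. c i \<in> S"
    "prod_even G H G' H' = fps_of_poly (gamma_poly c (degree (p * q) + 1)) * fU ^ (degree (p * q) + 1)"
    using gcone_imp_gamma_poly[OF P(1) S] by blast
  obtain c' where c': "\<forall>i. c' i \<in> S"
    "prod_odd G H G' H' = fps_of_poly (gamma_poly c' (degree (p * q))) * fU ^ degree (p * q)"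
    using gcone_imp_gamma_poly[OF P(2) S] by blast
  have "eval_fps_nat (p * q) = prod_even G H G' H' + fps_X * fU * prod_odd G H G' H'"
    unfolding eval_fps_nat_mult p(1) q(1) by (rule hadamard_decomp)
  then show ?thesis using symm_decomp_eqI[of "p * q" c c'] c c' that by metis
qed

lemma poly_in_bcone:
  assumes "\<And>i. 0 \<le> coeff a i" "a = 0 \<or> degree a < n"
  shows "fps_of_poly a * fU ^ r \<in> bcone 0 n r"
proof (cases "a = 0")
  case False
  have "fps_of_poly a * fU ^ r = (\<Sum>i\<le>degree a. fps_const (coeff a i) * fQ i r)"
    by (subst poly_as_sum_of_monoms[symmetric])
      (simp add: fps_of_poly_sum fps_of_poly_monom sum_distrib_right fQ_def mult.assoc)
  also have "\<dots> \<in> bcone 0 n r"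
    using assms False by (intro lcone_sum bcone_fQ) auto
  finally show ?thesis .
qed (simp add: lcone.zero)

lemma nonneg_num_poly: "nonneg_num r (fps_of_poly a * fU ^ r) \<Longrightarrow> 0 \<le> coeff a i"
  using fU_power_cancel[of r] by (auto simp: nonneg_num_def mult.left_commute[of _ "fps_of_poly a"])

lemma W_poly_0: "W_poly 0 = 0"
proof -
  have "fps_of_poly (W_poly 0) * fU ^ (degree (0 :: real poly) + 1) = 0"
    unfolding eval_fps_nat_W[symmetric] by (simp add: eval_fps_nat_def fps_eq_iff)
  moreover have "fU \<noteq> 0" using fU_cancel by auto
  ultimately show ?thesis by simp
qed

lemma symm_decomp_0: "symm_decomp 0 0 = (0, 0)"
proof -
  have "is_symm_decomp 0 0 (0, 0)" by (simp add: is_symm_decomp_def I_poly_def)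
  then show ?thesis
    using symm_decomp_ex1[of 0 0] is_symm_decomp_symm_decomp[of 0 0] by auto
qed

lemma nonneg_symm_decomp_mult:
  assumes "nonneg_symm_decomp (degree p) (W_poly p)" "nonneg_symm_decomp (degree q) (W_poly q)"
  shows "nonneg_symm_decomp (degree (p * q)) (W_poly (p * q))"
proof (cases "p = 0 \<or> q = 0")
  \<comment> \<open>With a zero factor the degree of the product need not be the sum of the
    degrees.\<close>
  case True
  then show ?thesis by (auto simp: W_poly_0 symm_decomp_0 nonneg_symm_decomp_def)
next
  case False
  then have deg: "degree (p * q) = degree p + degree q" by (simp add: degree_mult_eq)
  obtain a b where ab: "symm_decomp (degree p) (W_poly p) = (a, b)" by fastforce
  obtain a' b' where ab': "symm_decomp (degree q) (W_poly q) = (a', b')" by fastforce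
  note p = eval_fps_nat_decomp[OF ab] and q = eval_fps_nat_decomp[OF ab']
  have nn: "\<And>i. 0 \<le> coeff a i" "\<And>i. 0 \<le> coeff b i" "\<And>i. 0 \<le> coeff a' i" "\<And>i. 0 \<le> coeff b' i"
    using assms ab ab' by (auto simp: nonneg_symm_decomp_def)
  obtain c c' where c:
    "symm_decomp (degree (p * q)) (W_poly (p * q)) = (gamma_poly c (degree (p * q) + 1), gamma_poly c' (degree (p * q)))"
    "prod_even (fps_of_poly a * fU ^ (degree p + 1)) (fps_of_poly b * fU ^ degree p)
       (fps_of_poly a' * fU ^ (degree q + 1)) (fps_of_poly b' * fU ^ degree q)
     = fps_of_poly (gamma_poly c (degree (p * q) + 1)) * fU ^ (degree (p * q) + 1)"
    "prod_odd (fps_of_poly a * fU ^ (degree p + 1)) (fps_of_poly b * fU ^ degree p)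
       (fps_of_poly a' * fU ^ (degree q + 1)) (fps_of_poly b' * fU ^ degree q)
     = fps_of_poly (gamma_poly c' (degree (p * q))) * fU ^ degree (p * q)"
    using symm_decomp_mult[OF disjI1[OF refl] deg p(1-3) q(1-3)] by metis
  \<comment> \<open>\<open>c(2,3)\<close> identifies the numerators with the two components, so
    nonnegative numerators give nonnegative coefficients.\<close>
  note N = prod_nonneg_num[OF poly_in_bcone[OF nn(1) disjI2[OF p(4)]] poly_in_bcone[OF nn(2) p(5)]
      poly_in_bcone[OF nn(3) disjI2[OF q(4)]] poly_in_bcone[OF nn(4) q(5)], folded deg, unfolded c(2,3)]
  show ?thesis
    unfolding nonneg_symm_decomp_def c(1) using N[THEN nonneg_num_poly] by simp
qed

lemma gamma_positive_iff:
  "gamma_positive_symm_decomp d h \<longleftrightarrow>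
    (\<exists>c c'. (\<forall>i. c i \<in> {0..}) \<and> (\<forall>i. c' i \<in> {0..}) \<and> symm_decomp d h = (gamma_poly c (d + 1), gamma_poly c' d))"
  unfolding gamma_positive_symm_decomp_def by (cases "symm_decomp d h") (auto simp: gamma_poly_def)

lemma gamma_positive_symm_decomp_mult:
  assumes "gamma_positive_symm_decomp (degree p) (W_poly p)" "gamma_positive_symm_decomp (degree q) (W_poly q)"
  shows "gamma_positive_symm_decomp (degree (p * q)) (W_poly (p * q))"
proof (cases "p = 0 \<or> q = 0")
  case True
  then have "symm_decomp (degree (p * q)) (W_poly (p * q)) = (gamma_poly (\<lambda>_. 0) (degree (p * q) + 1), gamma_poly (\<lambda>_. 0) (degree (p * q)))"
    by (auto simp: W_poly_0 symm_decomp_0 gamma_poly_def)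
  then show ?thesis unfolding gamma_positive_iff by fastforce
next
  case False
  then have deg: "degree (p * q) = degree p + degree q" by (simp add: degree_mult_eq)
  obtain c1 c2 where c: "\<And>i. c1 i \<in> {0..}" "\<And>i. c2 i \<in> {0..}"
    "symm_decomp (degree p) (W_poly p) = (gamma_poly c1 (degree p + 1), gamma_poly c2 (degree p))"
    using assms(1) unfolding gamma_positive_iff by blast
  obtain c1' c2' where c': "\<And>i. c1' i \<in> {0..}" "\<And>i. c2' i \<in> {0..}"
    "symm_decomp (degree q) (W_poly q) = (gamma_poly c1' (degree q + 1), gamma_poly c2' (degree q))"
    using assms(2) unfolding gamma_positive_iff by blast
  show ?thesis
    using symm_decomp_mult[OF disjI2[OF refl] deg
      eval_fps_nat_decomp(1)[OF c(3)] gamma_poly_in_gcone[OF c(1)] gamma_poly_in_gcone[OF c(2)]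
      eval_fps_nat_decomp(1)[OF c'(3)] gamma_poly_in_gcone[OF c'(1)] gamma_poly_in_gcone[OF c'(2)]]
    unfolding gamma_positive_iff by metis
qed

theorem theorem1p4:
  fixes p q :: "real poly"
  shows "(nonneg_symm_decomp (degree p) (W_poly p) \<and> nonneg_symm_decomp (degree q) (W_poly q)
            \<longrightarrow> nonneg_symm_decomp (degree (p * q)) (W_poly (p * q)))
       \<and> (gamma_positive_symm_decomp (degree p) (W_poly p) \<and> gamma_positive_symm_decomp (degree q) (W_poly q)
            \<longrightarrow> gamma_positive_symm_decomp (degree (p * q)) (W_poly (p * q)))"
  using nonneg_symm_decomp_mult gamma_positive_symm_decomp_mult by blast

end
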